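(* Let $t\in\mathbb{N}$, let $f:2^\Omega\to\mathbb{R}$ be a set function with $\Omega=\{1,\dots,n\}$, and let $F$ be its multilinear extension. Then $f$ is $t$-sos-submodular if and only if the polynomial $G_2(x,y,s):=F(y)-F(x)-\sum_{i=1}^n(y_i-s_i)\frac{\partial F(y)}{\partial x_i}+\sum_{i=1}^n(x_i-s_i)\frac{\partial F(s)}{\partial x_i}$ is $(t+2)$-sos modulo $I_0[x,y,s]$.
   Context: $\mathbb{N}$ includes $0$. The multilinear extension (MLE) of a set function $f:2^\Omega\to\mathbb{R}$ is the unique multilinear polynomial $F\in\mathbb{R}[x_1,\dots,x_n]$ (every variable appears with power at most $1$ in every monomial) with $F(1_S)=f(S)$ for all $S\subseteq\Omega$, where $1_S\in\{0,1\}^n$ is the indicator vector of $S$. $\frac{\partial F(y)}{\partial x_i}$, $\frac{\partial F(s)}{\partial x_i}$ denote the partial derivative of $F$ with respect to its $i$-th argument, evaluated at $y$, $s$ respectively. For an ideal $I$ of a real polynomial ring, a polynomial $p$ is $t$-sos modulo $I$ if there are finitely many polynomials $q_1,\dots,q_m$ in that ring, each of degree at most $t$, with $p-\sum_{r=1}^m q_r^2\in I$. For $i\ne j$, $x_{-i,j}$ denotes the variables $x_1,\dots,x_n$ with $x_i,x_j$ removed, and $I_2[x_{-i,j}]=\langle x_k^2-x_k : k\neq i,j\rangle\subseteq\mathbb{R}[x_{-i,j}]$. The set function $f$ with MLE $F$ is $t$-sos-submodular if for all $i\neq j$ the polynomial $-\frac{\partial^2F(x)}{\partial x_i\partial x_j}$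 (which does not involve $x_i,x_j$) is $t$-sos modulo $I_2[x_{-i,j}]$. With variables $x=(x_1,\dots,x_n)$, $y=(y_1,\dots,y_n)$, $s=(s_1,\dots,s_n)$, $I_0[x,y,s]=\langle\{x_i^2-x_i,\ x_iy_i-s_i,\ x_is_i-s_i,\ y_i^2-y_i,\ y_is_i-s_i,\ s_i^2-s_i\}_{i=1,\dots,n}\rangle\subseteq\mathbb{R}[x,y,s]$. *)

theory Defs
  imports Complex_Main "HOL-Library.Poly_Mapping"
begin

type_synonym 'v monom = "'v \<Rightarrow>\<^sub>0 nat"
type_synonym 'v mpoly = "'v monom \<Rightarrow>\<^sub>0 real"

definition Var :: "'v \<Rightarrow> 'v mpoly" where
  "Var v = Poly_Mapping.single (Poly_Mapping.single v 1) 1"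

definition Const :: "real \<Rightarrow> 'v mpoly" where
  "Const c = Poly_Mapping.single 0 c"

text \<open>The ring of polynomials in the variables \<open>V\<close>, as a subset of all polynomials over \<open>'v\<close>.\<close>

definition polys :: "'v set \<Rightarrow> 'v mpoly set" where
  "polys V = {p. \<forall>m \<in> Poly_Mapping.keys p. Poly_Mapping.keys m \<subseteq> V}"

definition monom_deg :: "'v monom \<Rightarrow> nat" where
  "monom_deg m = (\<Sum>v\<in>Poly_Mapping.keys m. Poly_Mapping.lookup m v)"

text \<open>The total degree; the zero polynomial gets degree \<open>0\<close>.\<close>

definition total_deg :: "'v mpoly \<Rightarrow> nat" where
  "total_deg p = Max (insert 0 (monom_deg ` Poly_Mapping.keys p))"

definition eval :: "('v \<Rightarrow> real) \<Rightarrow> 'v mpoly \<Rightarrow> real" where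
  "eval a p = (\<Sum>m\<in>Poly_Mapping.keys p. Poly_Mapping.lookup p m *
     (\<Prod>v\<in>Poly_Mapping.keys m. a v ^ Poly_Mapping.lookup m v))"

definition subst :: "('v \<Rightarrow> 'w mpoly) \<Rightarrow> 'v mpoly \<Rightarrow> 'w mpoly" where
  "subst \<sigma> p = (\<Sum>m\<in>Poly_Mapping.keys p. Const (Poly_Mapping.lookup p m) *
     (\<Prod>v\<in>Poly_Mapping.keys m. \<sigma> v ^ Poly_Mapping.lookup m v))"

text \<open>Formal partial derivative. Subtraction of exponents truncates at \<open>0\<close>, but monomials without
  \<open>v\<close> are killed by their coefficient.\<close>

definition partial :: "'v \<Rightarrow> 'v mpoly \<Rightarrow> 'v mpoly" where
  "partial v p = (\<Sum>m\<in>Poly_Mapping.keys p.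
     Poly_Mapping.single (m - Poly_Mapping.single v 1)
       (real (Poly_Mapping.lookup m v) * Poly_Mapping.lookup p m))"

text \<open>The ideal generated by \<open>G\<close> in the ring \<open>polys V\<close>, for \<open>G \<subseteq> polys V\<close>.\<close>

definition ideal_gen :: "'v set \<Rightarrow> 'v mpoly set \<Rightarrow> 'v mpoly set" where
  "ideal_gen V G = {\<Sum>g\<in>A. h g * g | A h. finite A \<and> A \<subseteq> G \<and> (\<forall>g\<in>A. h g \<in> polys V)}"

definition sos_mod :: "'v set \<Rightarrow> nat \<Rightarrow> 'v mpoly set \<Rightarrow> 'v mpoly \<Rightarrow> bool" where
  "sos_mod V t I p \<longleftrightarrow> (\<exists>qs. (\<forall>q\<in>set qs. q \<in> polys V \<and> total_deg q \<le> t) \<and>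
     p - (\<Sum>q\<leftarrow>qs. q ^ 2) \<in> I)"

definition multilinear :: "'v mpoly \<Rightarrow> bool" where
  "multilinear p \<longleftrightarrow> (\<forall>m\<in>Poly_Mapping.keys p. \<forall>v. Poly_Mapping.lookup m v \<le> 1)"

text \<open>Set functions on \<open>{1..n}\<close> are functions \<open>nat set \<Rightarrow> real\<close> of which only the values on subsets
  of \<open>{1..n}\<close> are used.\<close>

definition is_mle :: "nat \<Rightarrow> (nat set \<Rightarrow> real) \<Rightarrow> nat mpoly \<Rightarrow> bool" where
  "is_mle n f F \<longleftrightarrow> F \<in> polys {1..n} \<and> multilinear F \<and>
     (\<forall>S\<subseteq>{1..n}. eval (\<lambda>i. of_bool (i \<in> S)) F = f S)"

definition mle :: "nat \<Rightarrow> (nat set \<Rightarrow> real) \<Rightarrow> nat mpoly" where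
  "mle n f = (THE F. is_mle n f F)"

definition sos_submodular :: "nat \<Rightarrow> nat \<Rightarrow> (nat set \<Rightarrow> real) \<Rightarrow> bool" where
  "sos_submodular t n f \<longleftrightarrow> (\<forall>i\<in>{1..n}. \<forall>j\<in>{1..n}. i \<noteq> j \<longrightarrow>
     (let V = {1..n} - {i, j} in
      sos_mod V t (ideal_gen V {Var k ^ 2 - Var k | k. k \<in> V})
        (- partial i (partial j (mle n f)))))"

datatype xys = X nat | Y nat | S nat

definition xys_vars :: "nat \<Rightarrow> xys set" where
  "xys_vars n = X ` {1..n} \<union> Y ` {1..n} \<union> S ` {1..n}"

definition I0 :: "nat \<Rightarrow> xys mpoly set" where
  "I0 n = ideal_gen (xys_vars n) (\<Union>i\<in>{1..n}.
     {Var (X i) ^ 2 - Var (X i), Var (X i) * Var (Y i) - Var (S i),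
      Var (X i) * Var (S i) - Var (S i), Var (Y i) ^ 2 - Var (Y i),
      Var (Y i) * Var (S i) - Var (S i), Var (S i) ^ 2 - Var (S i)})"

definition G2 :: "nat \<Rightarrow> nat mpoly \<Rightarrow> xys mpoly" where
  "G2 n F =
     (let at_x = subst (\<lambda>i. Var (X i)); at_y = subst (\<lambda>i. Var (Y i)); at_s = subst (\<lambda>i. Var (S i))
      in at_y F - at_x F
         - (\<Sum>i=1..n. (Var (Y i) - Var (S i)) * at_y (partial i F))
         + (\<Sum>i=1..n. (Var (X i) - Var (S i)) * at_s (partial i F)))"

text \<open>The multilinear extension exists and is unique, so the definite description in \<^const>\<open>mle\<close>
  is well-defined.\<close>

definition set_monom :: "'v set \<Rightarrow> 'v monom" where
  "set_monom T = (\<Sum>v\<in>T. Poly_Mapping.single v 1)"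

lemma lookup_set_monom:
  "finite T \<Longrightarrow> Poly_Mapping.lookup (set_monom T) v = (if v \<in> T then 1 else 0)"
  unfolding set_monom_def
  by (simp add: lookup_sum lookup_single when_def)

lemma keys_set_monom [simp]: "finite T \<Longrightarrow> Poly_Mapping.keys (set_monom T) = T"
  by (auto simp: in_keys_iff lookup_set_monom split: if_splits)

lemma multilinear_monom:
  assumes "multilinear p" "m \<in> Poly_Mapping.keys p"
  shows "m = set_monom (Poly_Mapping.keys m)"
proof (rule poly_mapping_eqI)
  fix v
  have "Poly_Mapping.lookup m v \<le> 1"
    using assms by (auto simp: multilinear_def)
  then show "Poly_Mapping.lookup m v = Poly_Mapping.lookup (set_monom (Poly_Mapping.keys m)) v"
    by (auto simp: lookup_set_monom in_keys_iff)
qed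

lemma eval_indicator:
  assumes "multilinear p" "finite A"
  shows "eval (\<lambda>i. of_bool (i \<in> A)) p = (\<Sum>T\<in>Pow A. Poly_Mapping.lookup p (set_monom T))"
proof -
  have mon: "(\<Prod>v\<in>Poly_Mapping.keys m. (of_bool (v \<in> A) :: real) ^ Poly_Mapping.lookup m v)
      = of_bool (Poly_Mapping.keys m \<subseteq> A)" for m
  proof (cases "Poly_Mapping.keys m \<subseteq> A")
    case True
    then show ?thesis by (auto intro!: prod.neutral)
  next
    case False
    then obtain v where v: "v \<in> Poly_Mapping.keys m" "v \<notin> A" by auto
    then have "\<exists>v\<in>Poly_Mapping.keys m. (of_bool (v \<in> A) :: real) ^ Poly_Mapping.lookup m v = 0"
      by (intro bexI[of _ v]) (auto simp: in_keys_iff)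
    then show ?thesis using False by (subst prod_zero) auto
  qed
  have inj: "inj_on set_monom (Pow A)"
    by (rule inj_on_inverseI[where g = Poly_Mapping.keys])
       (use assms(2) in \<open>auto dest: finite_subset\<close>)
  have "eval (\<lambda>i. of_bool (i \<in> A)) p
      = (\<Sum>m\<in>Poly_Mapping.keys p. Poly_Mapping.lookup p m * of_bool (Poly_Mapping.keys m \<subseteq> A))"
    unfolding eval_def by (simp only: mon)
  also have "\<dots> = (\<Sum>m\<in>{m \<in> Poly_Mapping.keys p. Poly_Mapping.keys m \<subseteq> A}. Poly_Mapping.lookup p m)"
    by (rule sum.mono_neutral_cong_right) auto
  also have "\<dots> = (\<Sum>m\<in>set_monom ` Pow A. Poly_Mapping.lookup p m)"
  proof (rule sum.mono_neutral_left)
    show "finite (set_monom ` Pow A)" using assms(2) by simp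
    show "{m \<in> Poly_Mapping.keys p. Poly_Mapping.keys m \<subseteq> A} \<subseteq> set_monom ` Pow A"
      using multilinear_monom[OF assms(1)] by auto
    show "\<forall>m\<in>set_monom ` Pow A - {m \<in> Poly_Mapping.keys p. Poly_Mapping.keys m \<subseteq> A}.
        Poly_Mapping.lookup p m = 0"
      using assms(2) by (auto simp: in_keys_iff finite_subset)
  qed
  also have "\<dots> = (\<Sum>T\<in>Pow A. Poly_Mapping.lookup p (set_monom T))"
    by (simp add: sum.reindex[OF inj])
  finally show ?thesis .
qed

lemma pow_sum_inversion:
  fixes f :: "'v set \<Rightarrow> real"
  shows "\<exists>c. \<forall>A. finite A \<longrightarrow> (\<Sum>T\<in>Pow A. c T) = f A"
proof -
  define R :: "('v set \<times> 'v set) set" where "R = {(T, A). finite A \<and> T \<subset> A}"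
  have wf: "wf R"
  proof (rule wf_subset[OF wf_measure[of card]], rule subrelI)
    fix T A assume "(T, A) \<in> R"
    then have "finite A" "T \<subset> A" by (simp_all add: R_def)
    then show "(T, A) \<in> measure card" using psubset_card_mono by (simp only: in_measure)
  qed
  define c where "c = wfrec R (\<lambda>c A. f A - (\<Sum>T\<in>Pow A - {A}. c T))"
  have c: "c A = f A - (\<Sum>T\<in>Pow A - {A}. c T)" if "finite A" for A
  proof -
    have "c A = f A - (\<Sum>T\<in>Pow A - {A}. cut c R A T)"
      unfolding c_def by (subst wfrec[OF wf]) simp
    also have "(\<Sum>T\<in>Pow A - {A}. cut c R A T) = (\<Sum>T\<in>Pow A - {A}. c T)"
      by (rule sum.cong) (use that in \<open>auto simp: cut_def R_def\<close>)
    finally show ?thesis .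
  qed
  have "(\<Sum>T\<in>Pow A. c T) = f A" if "finite A" for A
    using that c[OF that] by (simp add: sum.remove[of "Pow A" A])
  then show ?thesis by blast
qed

lemma ex1_is_mle: "\<exists>!F. is_mle n f F"
proof (rule ex_ex1I)
  obtain c where c: "\<And>A. finite A \<Longrightarrow> (\<Sum>T\<in>Pow A. c T) = f A"
    using pow_sum_inversion[of f] by blast
  define F :: "nat mpoly" where
    "F = (\<Sum>T\<in>Pow {1..n}. Poly_Mapping.single (set_monom T) (c T))"
  have keys: "Poly_Mapping.keys F \<subseteq> set_monom ` Pow {1..n}"
  proof -
    have "Poly_Mapping.lookup F m = 0" if "m \<notin> set_monom ` Pow {1..n}" for m
      unfolding F_def lookup_sum
      by (rule sum.neutral) (use that in \<open>auto simp: lookup_single when_def\<close>)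
    then show ?thesis by (auto simp: in_keys_iff)
  qed
  have look: "Poly_Mapping.lookup F (set_monom T) = c T" if "T \<subseteq> {1..n}" for T
  proof -
    have "set_monom U = set_monom T \<longleftrightarrow> U = T" if "U \<in> Pow {1..n}" for U
      using that \<open>T \<subseteq> {1..n}\<close> keys_set_monom[of U] keys_set_monom[of T]
      by (metis PowD finite_atLeastAtMost finite_subset)
    then have "Poly_Mapping.lookup F (set_monom T) = (\<Sum>U\<in>Pow {1..n}. if U = T then c U else 0)"
      unfolding F_def lookup_sum
      by (intro sum.cong) (auto simp: lookup_single when_def)
    also have "\<dots> = c T" using that by (subst sum.delta) auto
    finally show ?thesis .
  qed
  have ml: "multilinear F"
    unfolding multilinear_def
  proof (intro ballI allI)
    fix m v assume "m \<in> Poly_Mapping.keys F"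
    then obtain T where "T \<subseteq> {1..n}" "m = set_monom T" using keys by auto
    then show "Poly_Mapping.lookup m v \<le> 1"
      by (simp add: lookup_set_monom finite_subset[of T "{1..n}"])
  qed
  have "F \<in> polys {1..n}"
    unfolding polys_def
  proof (intro CollectI ballI)
    fix m assume "m \<in> Poly_Mapping.keys F"
    then obtain T where "T \<subseteq> {1..n}" "m = set_monom T" using keys by auto
    then show "Poly_Mapping.keys m \<subseteq> {1..n}"
      by (simp add: finite_subset[of T "{1..n}"])
  qed
  moreover have "eval (\<lambda>i. of_bool (i \<in> A)) F = f A" if "A \<subseteq> {1..n}" for A
  proof -
    have fin: "finite A" using that by (rule finite_subset) simp
    have "eval (\<lambda>i. of_bool (i \<in> A)) F = (\<Sum>T\<in>Pow A. c T)"
      unfolding eval_indicator[OF ml fin] by (rule sum.cong) (use that look in auto)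
    with c[OF fin] show ?thesis by simp
  qed
  ultimately have "is_mle n f F" using ml by (simp add: is_mle_def)
  then show "\<exists>F. is_mle n f F" ..
next
  fix F G assume F: "is_mle n f F" and G: "is_mle n f G"
  have eq: "T \<subseteq> {1..n} \<Longrightarrow> Poly_Mapping.lookup F (set_monom T) = Poly_Mapping.lookup G (set_monom T)"
    for T
  proof (induction "card T" arbitrary: T rule: less_induct)
    case less
    have fin: "finite T" using less.prems by (rule finite_subset) simp
    have "(\<Sum>U\<in>Pow T. Poly_Mapping.lookup F (set_monom U))
        = (\<Sum>U\<in>Pow T. Poly_Mapping.lookup G (set_monom U))"
      using F G less.prems eval_indicator[OF _ fin, of F] eval_indicator[OF _ fin, of G]
      by (simp add: is_mle_def)
    moreover have "(\<Sum>U\<in>Pow T - {T}. Poly_Mapping.lookup F (set_monom U))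
        = (\<Sum>U\<in>Pow T - {T}. Poly_Mapping.lookup G (set_monom U))"
    proof (rule sum.cong)
      fix U assume "U \<in> Pow T - {T}"
      then have "U \<subset> T" by auto
      then show "Poly_Mapping.lookup F (set_monom U) = Poly_Mapping.lookup G (set_monom U)"
        using less.hyps[of U] less.prems psubset_card_mono[OF fin] by auto
    qed simp
    ultimately show ?case using fin by (simp add: sum.remove[of "Pow T" T])
  qed
  have zero: "Poly_Mapping.lookup H m = 0"
    if "is_mle n f H" "m \<notin> set_monom ` Pow {1..n}" for H m
  proof (rule ccontr)
    assume "Poly_Mapping.lookup H m \<noteq> 0"
    then have m: "m \<in> Poly_Mapping.keys H" by (simp add: in_keys_iff)
    with that have "m = set_monom (Poly_Mapping.keys m)" "Poly_Mapping.keys m \<subseteq> {1..n}"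
      by (auto simp: is_mle_def polys_def intro: multilinear_monom)
    with that(2) show False by blast
  qed
  show "F = G"
  proof (rule poly_mapping_eqI)
    fix m
    show "Poly_Mapping.lookup F m = Poly_Mapping.lookup G m"
      using eq zero[OF F] zero[OF G] by (cases "m \<in> set_monom ` Pow {1..n}") auto
  qed
qed

lemma is_mle_mle: "is_mle n f (mle n f)"
  unfolding mle_def by (rule theI') (rule ex1_is_mle)

end

theory Submission
  imports Defs
begin

text \<open>
  Both ideals are the vanishing ideals of finite sets of points: the cube for the second derivatives,
  and the points \<open>(1\<^sub>A, 1\<^sub>B, 1\<^sub>A\<^sub>\<inter>\<^sub>B)\<close> for \<open>I0\<close> (lemma \<open>in_ideal_gen_if_vanishes\<close>). So
  both sides of the equivalence say that a function of finite sets is a sum of squares of polynomials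
  of bounded degree. Let \<open>g A = F(1\<^sub>A)\<close>. The partial derivatives of \<open>F\<close> become
  discrete derivatives of \<open>g\<close>, and \<open>G2\<close> becomes the sum of two linearization errors: that of \<open>g\<close>
  at \<open>A \<inter> B\<close>, on the way up to \<open>A\<close>, and that of \<open>g\<close> at \<open>B\<close>, on the way down to \<open>A \<inter> B\<close>.

  If \<open>g\<close> is sos-submodular, add the elements of the larger set one at a time in increasing order and
  telescope twice. Each linearization error becomes a sum over pairs \<open>i \<noteq> j\<close> of negated second
  derivatives, multiplied by \<open>(x\<^sub>i - s\<^sub>i) * (x\<^sub>j - s\<^sub>j)\<close> in the first case and by
  \<open>(y\<^sub>i - s\<^sub>i) * (y\<^sub>j - s\<^sub>j)\<close> in the second. These factors are 0 or 1 on the points, hence equal to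
  their squares. The second derivatives are taken at intermediate sets, which agree with the larger
  set below some index and with the smaller one above it; their indicators are obtained by
  substituting a variable for each coordinate, which does not change degrees. This gives squares of
  polynomials of degree at most \<open>t + 2\<close> (lemma \<open>sos_on_G2_value\<close>).

  Conversely, take \<open>C\<close> without \<open>i\<close> and \<open>j\<close>. At \<open>A = C \<union> {i, j}\<close> and \<open>B = C\<close> the value of \<open>G2\<close> is
  the negated second derivative of \<open>g\<close> at \<open>C\<close>. It is 0 if \<open>A\<close> is \<open>C\<close>, \<open>C \<union> {i}\<close> or \<open>C \<union> {j}\<close>,
  so every polynomial in a certificate is 0 there as well. Its value at the first point is thus a
  second difference in \<open>x\<^sub>i\<close> and \<open>x\<^sub>j\<close>, and taking it lowers the degree bound from \<open>t + 2\<close> to \<open>t\<close>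
  (lemma \<open>sos_on_second_deriv\<close>).
\<close>

section \<open>Polynomials as sums of monomials\<close>


lemma sum_singles: "(\<Sum>m\<in>Poly_Mapping.keys p. Poly_Mapping.single m (Poly_Mapping.lookup p m)) = p"
  by (rule poly_mapping_eqI)
     (auto simp: lookup_sum lookup_single when_def in_keys_iff)

lemma Var_power: "Var v ^ k = Poly_Mapping.single (Poly_Mapping.single v k) 1"
  by (induction k) (simp_all add: Var_def mult_single single_add[symmetric])

lemma prod_single_one:
  "finite A \<Longrightarrow> (\<Prod>v\<in>A. Poly_Mapping.single (g v) (1::real)) = Poly_Mapping.single (\<Sum>v\<in>A. g v) 1"
  by (induction rule: finite_induct) (simp_all add: mult_single)

lemma single_eq_Const_times_Vars:
  "Poly_Mapping.single m c =
     Const c * (\<Prod>v\<in>Poly_Mapping.keys m. Var v ^ Poly_Mapping.lookup m v)"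
  by (simp add: Var_power prod_single_one sum_singles Const_def mult_single)

lemma Const_simps [simp]:
  "Const 0 = 0" "Const 1 = 1" "Const (a + b) = Const a + Const b" "Const (- a) = - Const a"
  "Const (a * b) = Const a * Const b"
  by (simp_all add: Const_def single_add single_uminus mult_single)

text \<open>A homomorphism of rings, or a property closed under the ring operations, is controlled by its
  behaviour on constants and variables; this is how facts about arbitrary polynomials are derived
  below.\<close>

lemma mpoly_induct [consumes 1, case_names Const Var add mult]:
  assumes "p \<in> polys V"
    and Const: "\<And>c. P (Const c)"
    and Var: "\<And>v. v \<in> V \<Longrightarrow> P (Var v)"
    and add: "\<And>p q. P p \<Longrightarrow> P q \<Longrightarrow> P (p + q)"
    and mult: "\<And>p q. P p \<Longrightarrow> P q \<Longrightarrow> P (p * q)"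
  shows "P p"
proof -
  have one: "P 1" using Const[of 1] by simp
  have zero: "P 0" using Const[of 0] by simp
  have power: "P (q ^ k)" if "P q" for q k
    by (induction k) (simp_all add: one mult that)
  have prod: "P (\<Prod>v\<in>A. g v)" if "finite A" "\<And>v. v \<in> A \<Longrightarrow> P (g v)" for A :: "'a set" and g
    using that by (induction rule: finite_induct) (simp_all add: one mult)
  have sum: "P (\<Sum>m\<in>A. g m)" if "finite A" "\<And>m. m \<in> A \<Longrightarrow> P (g m)"
    for A :: "'a monom set" and g
    using that by (induction rule: finite_induct) (simp_all add: zero add)
  have "P (\<Sum>m\<in>Poly_Mapping.keys p. Poly_Mapping.single m (Poly_Mapping.lookup p m))"
    using assms(1)
    by (auto simp: single_eq_Const_times_Vars polys_def intro!: sum mult Const prod power Var)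
  then show ?thesis by (simp add: sum_singles)
qed

section \<open>Evaluation\<close>

text \<open>The value type is an arbitrary commutative monoid so that the same function serves evaluation at
  real points and substitution of polynomials for the variables.\<close>

definition monom_eval :: "('v \<Rightarrow> 'a::comm_monoid_mult) \<Rightarrow> 'v monom \<Rightarrow> 'a" where
  "monom_eval a m = (\<Prod>v\<in>Poly_Mapping.keys m. a v ^ Poly_Mapping.lookup m v)"

lemma monom_eval_superset:
  assumes "finite A" "Poly_Mapping.keys m \<subseteq> A"
  shows "monom_eval a m = (\<Prod>v\<in>A. a v ^ Poly_Mapping.lookup m v)"
  unfolding monom_eval_def
  by (rule prod.mono_neutral_left) (use assms in \<open>auto simp: in_keys_iff\<close>)

lemma monom_eval_add: "monom_eval a (m + k) = monom_eval a m * monom_eval a k"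
proof -
  let ?A = "Poly_Mapping.keys m \<union> Poly_Mapping.keys k"
  have "monom_eval a (m + k) = (\<Prod>v\<in>?A. a v ^ Poly_Mapping.lookup (m + k) v)"
    by (rule monom_eval_superset) (use keys_add[of m k] in auto)
  also have "\<dots> = (\<Prod>v\<in>?A. a v ^ Poly_Mapping.lookup m v) * (\<Prod>v\<in>?A. a v ^ Poly_Mapping.lookup k v)"
    by (simp add: lookup_add power_add prod.distrib)
  finally show ?thesis
    by (simp add: monom_eval_superset[of ?A])
qed

lemma eval_altdef:
  "eval a p = (\<Sum>m\<in>Poly_Mapping.keys p. Poly_Mapping.lookup p m * monom_eval a m)"
  by (simp add: eval_def monom_eval_def)

lemma eval_single: "eval a (Poly_Mapping.single m c) = c * monom_eval a m"
  by (simp add: eval_altdef)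

lemma eval_add [simp]: "eval a (p + q) = eval a p + eval a q"
  unfolding eval_altdef
  by (rule setsum_keys_plus_distrib) (simp_all add: algebra_simps)

lemma eval_zero [simp]: "eval a 0 = 0"
  by (simp add: eval_def)

lemma eval_sum [simp]: "eval a (\<Sum>i\<in>A. p i) = (\<Sum>i\<in>A. eval a (p i))"
  by (induction A rule: infinite_finite_induct) simp_all

lemma eval_mult [simp]: "eval a (p * q) = eval a p * eval a q"
proof -
  have "eval a (p * q) = eval a
     ((\<Sum>m\<in>Poly_Mapping.keys p. Poly_Mapping.single m (Poly_Mapping.lookup p m)) *
      (\<Sum>k\<in>Poly_Mapping.keys q. Poly_Mapping.single k (Poly_Mapping.lookup q k)))"
    by (simp add: sum_singles)
  also have "\<dots> = eval a p * eval a q"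
    unfolding sum_product
    by (simp add: mult_single eval_single monom_eval_add eval_altdef[of a p] eval_altdef[of a q]
        sum_product mult_ac)
  finally show ?thesis .
qed

lemma eval_Const [simp]: "eval a (Const c) = c"
  by (simp add: Const_def eval_single monom_eval_def)

lemma eval_one [simp]: "eval a 1 = 1"
  using eval_Const[of a 1] by simp

lemma eval_uminus [simp]: "eval a (- p) = - eval a p"
  using eval_add[of a p "- p"] by simp

lemma eval_minus [simp]: "eval a (p - q) = eval a p - eval a q"
  using eval_add[of a p "- q"] by simp

lemma eval_Var [simp]: "eval a (Var v) = a v"
  by (simp add: Var_def eval_single monom_eval_def)

lemma eval_power [simp]: "eval a (p ^ k) = eval a p ^ k"
  by (induction k) simp_all

lemma eval_prod [simp]: "eval a (\<Prod>i\<in>A. p i) = (\<Prod>i\<in>A. eval a (p i))"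
  by (induction A rule: infinite_finite_induct) simp_all

lemma eval_sum_list [simp]: "eval a (\<Sum>q\<leftarrow>qs. h q) = (\<Sum>q\<leftarrow>qs. eval a (h q))"
  by (induction qs) simp_all

lemma eval_subst [simp]: "eval a (subst \<sigma> p) = eval (\<lambda>v. eval a (\<sigma> v)) p"
  unfolding subst_def by (simp add: eval_def[of "\<lambda>v. eval a (\<sigma> v)" p])

lemma eval_cong:
  assumes "p \<in> polys V" "\<And>v. v \<in> V \<Longrightarrow> a v = b v"
  shows "eval a p = eval b p"
  using assms(1) by (induction rule: mpoly_induct) (use assms(2) in simp_all)

section \<open>Polynomials of bounded degree\<close>

text \<open>The degree bound and the restriction to the variables in \<open>V\<close> are carried through the ring
  operations together.\<close>

definition polys_le :: "'v set \<Rightarrow> nat \<Rightarrow> 'v mpoly set" where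
  "polys_le V d = {p \<in> polys V. total_deg p \<le> d}"

lemma polys_le_iff:
  "p \<in> polys_le V d \<longleftrightarrow>
     (\<forall>m\<in>Poly_Mapping.keys p. Poly_Mapping.keys m \<subseteq> V \<and> monom_deg m \<le> d)"
  by (auto simp: polys_le_def polys_def total_deg_def)

lemma polys_conv_polys_le: "p \<in> polys V \<longleftrightarrow> (\<exists>d. p \<in> polys_le V d)"
  by (auto simp: polys_le_def)

lemma polys_le_mono: "p \<in> polys_le V d \<Longrightarrow> V \<subseteq> W \<Longrightarrow> d \<le> e \<Longrightarrow> p \<in> polys_le W e"
  unfolding polys_le_iff by (meson le_trans subset_trans)

lemma monom_deg_add: "monom_deg (m + k) = monom_deg m + monom_deg k"
  unfolding monom_deg_def
  by (rule setsum_keys_plus_distrib) simp_all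

lemma polys_le_Const [simp]: "Const c \<in> polys_le V d"
  by (auto simp: polys_le_iff Const_def monom_deg_def)

lemma polys_le_zero [simp]: "0 \<in> polys_le V d"
  using polys_le_Const[of 0] by simp

lemma polys_le_one [simp]: "1 \<in> polys_le V d"
  using polys_le_Const[of 1] by simp

lemma polys_le_Var: "v \<in> V \<Longrightarrow> Var v \<in> polys_le V 1"
  by (auto simp: polys_le_iff Var_def monom_deg_def)

lemma polys_le_add: "p \<in> polys_le V d \<Longrightarrow> q \<in> polys_le V d \<Longrightarrow> p + q \<in> polys_le V d"
  using keys_add[of p q] by (auto simp: polys_le_iff)

lemma polys_le_uminus: "p \<in> polys_le V d \<Longrightarrow> - p \<in> polys_le V d"
  by (auto simp: polys_le_iff in_keys_iff)

lemma polys_le_minus: "p \<in> polys_le V d \<Longrightarrow> q \<in> polys_le V d \<Longrightarrow> p - q \<in> polys_le V d"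
  using polys_le_add[of p V d "- q"] polys_le_uminus[of q V d] by simp

lemma polys_le_mult:
  assumes "p \<in> polys_le V d" "q \<in> polys_le V e"
  shows "p * q \<in> polys_le V (d + e)"
  unfolding polys_le_iff
proof
  fix m assume "m \<in> Poly_Mapping.keys (p * q)"
  then obtain k l where m: "m = k + l" "k \<in> Poly_Mapping.keys p" "l \<in> Poly_Mapping.keys q"
    using keys_mult[of p q] by blast
  with assms show "Poly_Mapping.keys m \<subseteq> V \<and> monom_deg m \<le> d + e"
    using keys_add[of k l] by (fastforce simp: polys_le_iff monom_deg_add intro: add_mono)
qed

lemma polys_le_power: "p \<in> polys_le V d \<Longrightarrow> p ^ k \<in> polys_le V (k * d)"
  by (induction k) (auto intro: polys_le_mult)

lemma polys_le_sum:
  "(\<And>i. i \<in> A \<Longrightarrow> p i \<in> polys_le V d) \<Longrightarrow> (\<Sum>i\<in>A. p i) \<in> polys_le V d"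
  by (induction A rule: infinite_finite_induct) (auto intro: polys_le_add)

lemma polys_le_prod:
  "(\<And>i. i \<in> A \<Longrightarrow> p i \<in> polys_le V (d i)) \<Longrightarrow> (\<Prod>i\<in>A. p i) \<in> polys_le V (\<Sum>i\<in>A. d i)"
  by (induction A rule: infinite_finite_induct) (auto intro: polys_le_mult)

lemma polys_le_monom_eval:
  assumes "\<And>v. v \<in> Poly_Mapping.keys m \<Longrightarrow> \<sigma> v \<in> polys_le W 1"
  shows "monom_eval \<sigma> m \<in> polys_le W (monom_deg m)"
proof -
  have "\<sigma> v ^ Poly_Mapping.lookup m v \<in> polys_le W (Poly_Mapping.lookup m v)"
    if "v \<in> Poly_Mapping.keys m" for v
    using polys_le_power[OF assms[OF that], of "Poly_Mapping.lookup m v"] by simp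
  then show ?thesis
    unfolding monom_eval_def monom_deg_def by (rule polys_le_prod)
qed

lemma subst_altdef:
  "subst \<sigma> p = (\<Sum>m\<in>Poly_Mapping.keys p. Const (Poly_Mapping.lookup p m) * monom_eval \<sigma> m)"
  by (simp add: subst_def monom_eval_def)

lemma polys_le_subst:
  assumes "p \<in> polys_le V d" "\<And>v. v \<in> V \<Longrightarrow> \<sigma> v \<in> polys_le W 1"
  shows "subst \<sigma> p \<in> polys_le W d"
  unfolding subst_altdef
proof (rule polys_le_sum)
  fix m assume "m \<in> Poly_Mapping.keys p"
  then have "Poly_Mapping.keys m \<subseteq> V" "monom_deg m \<le> d"
    using assms(1) by (auto simp: polys_le_iff)
  moreover from this have "monom_eval \<sigma> m \<in> polys_le W (monom_deg m)"
    using assms(2) by (blast intro: polys_le_monom_eval)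
  ultimately have "monom_eval \<sigma> m \<in> polys_le W (monom_deg m)" "monom_deg m \<le> d"
    by blast+
  then show "Const (Poly_Mapping.lookup p m) * monom_eval \<sigma> m \<in> polys_le W d"
    using polys_le_mult[OF polys_le_Const, of "monom_eval \<sigma> m" W d _ 0]
    by (auto intro: polys_le_mono)
qed

lemma polys_Const: "Const c \<in> polys V"
  and polys_zero: "0 \<in> polys V"
  and polys_one: "1 \<in> polys V"
  by (auto simp: polys_conv_polys_le)

lemma polys_Var: "v \<in> V \<Longrightarrow> Var v \<in> polys V"
  using polys_le_Var[of v V] by (simp add: polys_le_def)

lemma polys_uminus: "p \<in> polys V \<Longrightarrow> - p \<in> polys V"
  using polys_le_uminus[of p V "total_deg p"] by (simp add: polys_le_def)

lemma polys_mult: "p \<in> polys V \<Longrightarrow> q \<in> polys V \<Longrightarrow> p * q \<in> polys V"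
  using polys_le_mult[of p V "total_deg p" q "total_deg q"] by (simp add: polys_le_def)

lemma polys_add: "p \<in> polys V \<Longrightarrow> q \<in> polys V \<Longrightarrow> p + q \<in> polys V"
  using keys_add[of p q] by (auto simp: polys_def)

lemma polys_minus: "p \<in> polys V \<Longrightarrow> q \<in> polys V \<Longrightarrow> p - q \<in> polys V"
  using polys_add[of p V "- q"] polys_uminus[of q V] by simp

lemma polys_power: "p \<in> polys V \<Longrightarrow> p ^ k \<in> polys V"
  by (induction k) (auto intro: polys_one polys_mult)

lemma polys_sum: "(\<And>i. i \<in> A \<Longrightarrow> p i \<in> polys V) \<Longrightarrow> (\<Sum>i\<in>A. p i) \<in> polys V"
  by (induction A rule: infinite_finite_induct) (auto intro: polys_zero polys_add)

lemma polys_prod: "(\<And>i. i \<in> A \<Longrightarrow> p i \<in> polys V) \<Longrightarrow> (\<Prod>i\<in>A. p i) \<in> polys V"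
  by (induction A rule: infinite_finite_induct) (auto intro: polys_one polys_mult)

lemma polys_sum_list: "(\<And>q. q \<in> set qs \<Longrightarrow> h q \<in> polys V) \<Longrightarrow> (\<Sum>q\<leftarrow>qs. h q) \<in> polys V"
  by (induction qs) (auto intro: polys_zero polys_add)

lemma polys_subst:
  "p \<in> polys V \<Longrightarrow> (\<And>v. v \<in> V \<Longrightarrow> \<sigma> v \<in> polys_le W 1) \<Longrightarrow> subst \<sigma> p \<in> polys W"
  using polys_le_subst[of p V "total_deg p" \<sigma> W]
  by (auto simp: polys_le_def)

section \<open>Ideals\<close>

lemma ideal_gen_generator:
  assumes "g \<in> G"
  shows "g \<in> ideal_gen V G"
proof -
  have "g = (\<Sum>g\<in>{g}. 1 * g)" by simp
  then show ?thesis
    unfolding ideal_gen_def mem_Collect_eq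
    by (intro exI[of _ "{g}"] exI[of _ "\<lambda>_. 1"]) (use assms polys_one in auto)
qed

lemma ideal_gen_add:
  assumes "p \<in> ideal_gen V G" "q \<in> ideal_gen V G"
  shows "p + q \<in> ideal_gen V G"
proof -
  obtain A h where A: "p = (\<Sum>g\<in>A. h g * g)" "finite A" "A \<subseteq> G" "\<forall>g\<in>A. h g \<in> polys V"
    using assms(1) by (auto simp: ideal_gen_def)
  obtain B k where B: "q = (\<Sum>g\<in>B. k g * g)" "finite B" "B \<subseteq> G" "\<forall>g\<in>B. k g \<in> polys V"
    using assms(2) by (auto simp: ideal_gen_def)
  define l where "l g = (if g \<in> A then h g else 0) + (if g \<in> B then k g else 0)" for g
  have "p = (\<Sum>g\<in>A \<union> B. (if g \<in> A then h g else 0) * g)"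
    unfolding A by (rule sum.mono_neutral_cong_left) (use A B in auto)
  moreover have "q = (\<Sum>g\<in>A \<union> B. (if g \<in> B then k g else 0) * g)"
    unfolding B by (rule sum.mono_neutral_cong_left) (use A B in auto)
  ultimately have "p + q = (\<Sum>g\<in>A \<union> B. l g * g)"
    by (simp add: l_def distrib_right sum.distrib)
  moreover have "\<forall>g\<in>A \<union> B. l g \<in> polys V"
    using A B by (auto simp: l_def polys_zero intro: polys_add)
  ultimately show ?thesis
    unfolding ideal_gen_def mem_Collect_eq
    by (intro exI[of _ "A \<union> B"] exI[of _ l]) (use A B in auto)
qed

lemma ideal_gen_mult:
  assumes "r \<in> polys V" "p \<in> ideal_gen V G"
  shows "r * p \<in> ideal_gen V G"
proof -
  obtain A h where A: "p = (\<Sum>g\<in>A. h g * g)" "finite A" "A \<subseteq> G" "\<forall>g\<in>A. h g \<in> polys V"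
    using assms(2) by (auto simp: ideal_gen_def)
  have "r * p = (\<Sum>g\<in>A. (r * h g) * g)"
    by (simp add: A sum_distrib_left mult.assoc)
  then show ?thesis
    unfolding ideal_gen_def mem_Collect_eq
    by (intro exI[of _ A] exI[of _ "\<lambda>g. r * h g"]) (use A assms in \<open>auto intro: polys_mult\<close>)
qed

lemma ideal_gen_zero: "0 \<in> ideal_gen V G"
  unfolding ideal_gen_def mem_Collect_eq by (intro exI[of _ "{}"]) auto

lemma ideal_gen_uminus: "p \<in> ideal_gen V G \<Longrightarrow> - p \<in> ideal_gen V G"
  using ideal_gen_mult[of "- 1" V p G] by (simp add: polys_uminus polys_one)

lemma ideal_gen_sum:
  "(\<And>i. i \<in> A \<Longrightarrow> p i \<in> ideal_gen V G) \<Longrightarrow> (\<Sum>i\<in>A. p i) \<in> ideal_gen V G"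
  by (induction A rule: infinite_finite_induct) (auto intro: ideal_gen_zero ideal_gen_add)

lemma eval_ideal_gen:
  assumes "p \<in> ideal_gen V G" "\<And>g. g \<in> G \<Longrightarrow> eval a g = 0"
  shows "eval a p = 0"
  using assms by (auto simp: ideal_gen_def subset_iff)

section \<open>Ideals of finite sets of points\<close>

text \<open>The variables in \<open>W\<close> take the values 0 and 1 modulo the ideal and determine all others, so the
  zeros of the ideal correspond to the subsets \<open>C\<close> of \<open>W\<close>. The product
  \<open>e C = (\<Prod>w\<in>C. w) * (\<Prod>w\<in>W - C. 1 - w)\<close> is an idempotent modulo the ideal,
  1 at the point of \<open>C\<close> and 0 at the other points. Modulo the ideal, \<open>e C * v\<close> is \<open>e C\<close> times the value of \<open>v\<close> there, first for variables and
  hence for all polynomials. Since \<open>(\<Sum>C\<in>Pow W. e C) = (\<Prod>w\<in>W. w + (1 - w)) = 1\<close>, a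
  polynomial is congruent to the sum of its values times these idempotents, and it lies in the ideal
  as soon as all these values are 0.\<close>

lemma in_ideal_gen_if_vanishes:
  fixes W V :: "'v set" and ext :: "'v set \<Rightarrow> 'v \<Rightarrow> real"
  assumes W: "finite W" "W \<subseteq> V"
    and boolean: "\<And>w. w \<in> W \<Longrightarrow> Var w ^ 2 - Var w \<in> ideal_gen V G"
    and determined: "\<And>v. v \<in> V - W \<Longrightarrow> \<exists>r\<in>polys W. Var v - r \<in> ideal_gen V G"
    and p: "p \<in> polys V"
    and zeros: "\<And>C. C \<subseteq> W \<Longrightarrow> \<exists>a. (\<forall>w\<in>W. a w = of_bool (w \<in> C)) \<and>
                  (\<forall>g\<in>G. eval a g = 0) \<and> eval a p = 0"
  shows "p \<in> ideal_gen V G"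
proof -
  let ?I = "ideal_gen V G"
  define e :: "'v set \<Rightarrow> 'v mpoly" where "e C = (\<Prod>w\<in>C. Var w) * (\<Prod>w\<in>W - C. 1 - Var w)" for C
  have e_polys: "e C \<in> polys V" if "C \<subseteq> W" for C
    unfolding e_def using that W
    by (auto intro!: polys_mult polys_prod polys_minus polys_one polys_Var)
  have "e C * p \<in> ?I" if C: "C \<subseteq> W" for C
  proof -
    obtain a where a: "\<forall>w\<in>W. a w = of_bool (w \<in> C)" "\<forall>g\<in>G. eval a g = 0" "eval a p = 0"
      using zeros[OF C] by blast
    define P where "P q \<longleftrightarrow> q \<in> polys V \<and> e C * (q - Const (eval a q)) \<in> ?I" for q
    have finC: "finite C" using C W(1) by (rule finite_subset)
    have add: "P (q + r)" if "P q" "P r" for q r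
    proof -
      have "e C * (q - Const (eval a q)) + e C * (r - Const (eval a r)) \<in> ?I"
        using that by (intro ideal_gen_add) (auto simp: P_def)
      also have "e C * (q - Const (eval a q)) + e C * (r - Const (eval a r)) =
          e C * (q + r - Const (eval a (q + r)))" by (simp add: algebra_simps)
      finally show ?thesis using that by (simp add: P_def polys_add)
    qed
    have mult: "P (q * r)" if "P q" "P r" for q r
    proof -
      have "r * (e C * (q - Const (eval a q))) + Const (eval a q) * (e C * (r - Const (eval a r))) \<in> ?I"
        using that by (intro ideal_gen_add; intro ideal_gen_mult[where p = "e C * _"])
          (auto simp: P_def polys_Const)
      also have "r * (e C * (q - Const (eval a q))) + Const (eval a q) * (e C * (r - Const (eval a r)))
          = e C * (q * r - Const (eval a (q * r)))" by (simp add: algebra_simps)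
      finally show ?thesis using that by (simp add: P_def polys_mult)
    qed
    have Const: "P (Const c)" for c
      by (simp add: P_def polys_Const ideal_gen_zero)
    have VarW: "P (Var w)" if w: "w \<in> W" for w
    proof (cases "w \<in> C")
      case True
      have r: "(\<Prod>w\<in>C - {w}. Var w) * (\<Prod>w\<in>W - C. 1 - Var w) \<in> polys V"
        using C W by (auto intro!: polys_mult polys_prod polys_minus polys_one polys_Var)
      have "e C = Var w * (\<Prod>w\<in>C - {w}. Var w) * (\<Prod>w\<in>W - C. 1 - Var w)"
        using True finC by (simp add: e_def prod.remove[of C w])
      then have "e C * (Var w - Const (eval a (Var w))) =
          (\<Prod>w\<in>C - {w}. Var w) * (\<Prod>w\<in>W - C. 1 - Var w) * (Var w ^ 2 - Var w)"
        using True a w by (simp add: algebra_simps power2_eq_square)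
      then show ?thesis
        using ideal_gen_mult[OF r boolean[OF w]] w W by (auto simp: P_def intro: polys_Var)
    next
      case False
      have r: "- ((\<Prod>w\<in>C. Var w) * (\<Prod>w\<in>(W - C) - {w}. 1 - Var w)) \<in> polys V"
        using C W by (auto intro!: polys_uminus polys_mult polys_prod polys_minus polys_one polys_Var)
      have e: "e C = (\<Prod>w\<in>C. Var w) * ((1 - Var w) * (\<Prod>w\<in>(W - C) - {w}. 1 - Var w))"
        using False w W by (simp add: e_def prod.remove[of "W - C" w])
      have "e C * (Var w - Const (eval a (Var w))) =
          - ((\<Prod>w\<in>C. Var w) * (\<Prod>w\<in>(W - C) - {w}. 1 - Var w)) * (Var w ^ 2 - Var w)"
        using False a w unfolding e by (simp add: algebra_simps power2_eq_square)
      then show ?thesis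
        using ideal_gen_mult[OF r boolean[OF w]] w W by (auto simp: P_def intro: polys_Var)
    qed
    have polysW: "P r" if "r \<in> polys W" for r
      using that by (induction rule: mpoly_induct) (simp_all add: Const VarW add mult)
    have Var: "P (Var v)" if v: "v \<in> V" for v
    proof (cases "v \<in> W")
      case True
      then show ?thesis by (rule VarW)
    next
      case False
      then obtain r where r: "r \<in> polys W" "Var v - r \<in> ?I"
        using determined v by blast
      have "eval a (Var v - r) = 0"
        using r(2) by (rule eval_ideal_gen) (use a(2) in auto)
      then have "e C * (Var v - r) + e C * (r - Const (eval a r)) =
          e C * (Var v - Const (eval a (Var v)))"
        by (simp add: algebra_simps)
      moreover have "e C * (Var v - r) + e C * (r - Const (eval a r)) \<in> ?I"
        using r(2) polysW[OF r(1)] e_polys[OF C]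
        by (intro ideal_gen_add) (auto simp: P_def intro: ideal_gen_mult)
      ultimately show ?thesis using v by (simp add: P_def polys_Var)
    qed
    have "P p"
      using p by (induction rule: mpoly_induct) (simp_all add: Const Var add mult)
    then show ?thesis using a(3) by (simp add: P_def)
  qed
  then have "(\<Sum>C\<in>Pow W. e C * p) \<in> ?I"
    by (intro ideal_gen_sum) auto
  also have "(\<Sum>C\<in>Pow W. e C * p) = (\<Prod>w\<in>W. Var w + (1 - Var w)) * p"
    unfolding prod_add[OF W(1)] e_def by (simp add: sum_distrib_right)
  finally show ?thesis by simp
qed

section \<open>Partial derivatives of multilinear polynomials\<close>

lemma keys_partial:
  "Poly_Mapping.keys (partial i p) \<subseteq>
     (\<lambda>m. m - Poly_Mapping.single i 1) ` {m \<in> Poly_Mapping.keys p. Poly_Mapping.lookup m i \<noteq> 0}"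
proof -
  have "Poly_Mapping.keys (partial i p) \<subseteq> (\<Union>m\<in>Poly_Mapping.keys p. Poly_Mapping.keys
          (Poly_Mapping.single (m - Poly_Mapping.single i 1)
            (real (Poly_Mapping.lookup m i) * Poly_Mapping.lookup p m)))"
    unfolding partial_def by (rule keys_sum)
  also have "\<dots> \<subseteq> (\<lambda>m. m - Poly_Mapping.single i 1) `
      {m \<in> Poly_Mapping.keys p. Poly_Mapping.lookup m i \<noteq> 0}"
    by auto
  finally show ?thesis .
qed

lemma multilinear_partial:
  assumes "multilinear p"
  shows "multilinear (partial i p)"
  unfolding multilinear_def
proof (intro ballI allI)
  fix k v assume "k \<in> Poly_Mapping.keys (partial i p)"
  then obtain m where "m \<in> Poly_Mapping.keys p" "k = m - Poly_Mapping.single i 1"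
    using keys_partial[of i p] by blast
  with assms have "Poly_Mapping.lookup m v \<le> 1" "k = m - Poly_Mapping.single i 1"
    by (auto simp: multilinear_def)
  then show "Poly_Mapping.lookup k v \<le> 1"
    by (simp add: lookup_minus)
qed

lemma polys_partial:
  assumes "multilinear p" "p \<in> polys V"
  shows "partial i p \<in> polys (V - {i})"
  unfolding polys_def
proof (intro CollectI ballI subsetI)
  fix k v assume "k \<in> Poly_Mapping.keys (partial i p)" and v: "v \<in> Poly_Mapping.keys k"
  then obtain m where m: "m \<in> Poly_Mapping.keys p" "k = m - Poly_Mapping.single i 1"
    using keys_partial[of i p] by blast
  then have "Poly_Mapping.lookup m i \<le> 1" "Poly_Mapping.keys m \<subseteq> V"
    using assms by (auto simp: multilinear_def polys_def)
  with v m(2) show "v \<in> V - {i}"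
    by (auto simp: in_keys_iff lookup_minus lookup_single when_def split: if_splits)
qed

text \<open>A multilinear polynomial is affine in each variable, and the slope of an affine function is its
  increment between 0 and 1.\<close>

lemma eval_partial:
  assumes "multilinear p"
  shows "eval a (partial i p) = eval (a(i := 1)) p - eval (a(i := 0)) p"
proof -
  have "real (Poly_Mapping.lookup m i) * monom_eval a (m - Poly_Mapping.single i 1) =
      monom_eval (a(i := 1)) m - monom_eval (a(i := 0)) m"
    if m: "m \<in> Poly_Mapping.keys p" for m
  proof (cases "Poly_Mapping.lookup m i = 0")
    case True
    then have "monom_eval (a(i := c)) m = monom_eval a m" for c
      unfolding monom_eval_def by (intro prod.cong) (auto simp: in_keys_iff)
    with True show ?thesis by simp
  next
    case False
    let ?k = "m - Poly_Mapping.single i 1"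
    have i: "Poly_Mapping.lookup m i = 1"
      using False assms m by (metis multilinear_def le_neq_implies_less less_one)
    then have "m = Poly_Mapping.single i 1 + ?k"
      by (intro poly_mapping_eqI) (auto simp: lookup_add lookup_minus lookup_single when_def)
    then have "monom_eval b m = b i * monom_eval b ?k" for b :: "'a \<Rightarrow> real"
      using monom_eval_add[of b "Poly_Mapping.single i 1" ?k] by (simp add: monom_eval_def)
    moreover have "monom_eval (a(i := c)) ?k = monom_eval a ?k" for c
      unfolding monom_eval_def using i
      by (intro prod.cong) (auto simp: in_keys_iff lookup_minus)
    ultimately show ?thesis using i by simp
  qed
  note * = this
  show ?thesis
    unfolding partial_def eval_sum eval_single eval_altdef[of _ p] sum_subtractf[symmetric]
    by (intro sum.cong refl)
       (simp only: right_diff_distrib[symmetric] *[symmetric] mult_ac)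
qed

section \<open>Discrete derivatives of set functions\<close>

text \<open>Removing \<open>i\<close> from \<open>A\<close> makes the value independent of whether \<open>i\<close> belongs to \<open>A\<close>, just as
  the partial derivative of a multilinear polynomial does not involve its variable.\<close>

definition discrete_deriv :: "'v \<Rightarrow> ('v set \<Rightarrow> real) \<Rightarrow> 'v set \<Rightarrow> real" where
  "discrete_deriv i g A = g (insert i A) - g (A - {i})"

definition indicator_point :: "'v set \<Rightarrow> 'v \<Rightarrow> real" where
  "indicator_point A = (\<lambda>v. of_bool (v \<in> A))"

lemma eval_partial_indicator:
  assumes "multilinear p"
  shows "eval (indicator_point A) (partial i p) =
           discrete_deriv i (\<lambda>B. eval (indicator_point B) p) A"
proof -
  have "(indicator_point A)(i := 1) = indicator_point (insert i A)"
    "(indicator_point A)(i := 0) = indicator_point (A - {i})"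
    by (auto simp: indicator_point_def fun_eq_iff)
  then show ?thesis
    by (simp add: eval_partial[OF assms] discrete_deriv_def)
qed

text \<open>The elements of \<open>U\<close> are added to \<open>A\<close> one at a time, in increasing order. The fixed order matters
  for what follows: the intermediate sets \<open>A \<union> {k\<in>U. k < i}\<close> have indicator vectors whose
  coordinates are single variables, so that passing to them does not raise degrees.\<close>

lemma discrete_deriv_telescope:
  fixes h :: "'v::linorder set \<Rightarrow> real"
  assumes "finite U" "U \<inter> A = {}"
  shows "h (A \<union> U) - h A = (\<Sum>i\<in>U. discrete_deriv i h (A \<union> {k\<in>U. k < i}))"
  using assms
proof (induction U rule: finite_linorder_max_induct)
  case (insert b U)
  have "(\<Sum>i\<in>insert b U. discrete_deriv i h (A \<union> {k\<in>insert b U. k < i})) =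
      discrete_deriv b h (A \<union> {k\<in>insert b U. k < b}) +
      (\<Sum>i\<in>U. discrete_deriv i h (A \<union> {k\<in>insert b U. k < i}))"
    using insert.hyps by (subst sum.insert) auto
  also have "{k\<in>insert b U. k < b} = U"
    using insert.hyps by auto
  also have "(\<Sum>i\<in>U. discrete_deriv i h (A \<union> {k\<in>insert b U. k < i})) =
      (\<Sum>i\<in>U. discrete_deriv i h (A \<union> {k\<in>U. k < i}))"
  proof (rule sum.cong)
    fix i assume "i \<in> U"
    with insert.hyps have "{k\<in>insert b U. k < i} = {k\<in>U. k < i}" by auto
    then show "discrete_deriv i h (A \<union> {k\<in>insert b U. k < i}) =
        discrete_deriv i h (A \<union> {k\<in>U. k < i})" by simp
  qed simp
  also have "\<dots> = h (A \<union> U) - h A"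
    using insert by simp
  also have "discrete_deriv b h (A \<union> U) = h (A \<union> insert b U) - h (A \<union> U)"
    using insert.hyps insert.prems by (auto simp: discrete_deriv_def)
  finally show ?case by simp
qed simp

text \<open>The error of the linear approximation of \<open>g\<close> at the smaller set: telescope \<open>g\<close>, then telescope
  each of the first derivatives from \<open>A\<close> up to the set where it occurs.\<close>

lemma linearization_below:
  fixes g :: "'v::linorder set \<Rightarrow> real"
  assumes "finite U" "U \<inter> A = {}"
  shows "g A + (\<Sum>j\<in>U. discrete_deriv j g A) - g (A \<union> U) =
    (\<Sum>j\<in>U. \<Sum>i\<in>{i\<in>U. i < j}. - discrete_deriv i (discrete_deriv j g) (A \<union> {k\<in>U. k < i}))"
proof -
  have "discrete_deriv j g A - discrete_deriv j g (A \<union> {k\<in>U. k < j}) =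
    (\<Sum>i\<in>{i\<in>U. i < j}. - discrete_deriv i (discrete_deriv j g) (A \<union> {k\<in>U. k < i}))" for j
  proof -
    have "discrete_deriv j g (A \<union> {k\<in>U. k < j}) - discrete_deriv j g A =
        (\<Sum>i\<in>{i\<in>U. i < j}. discrete_deriv i (discrete_deriv j g)
          (A \<union> {k\<in>{k\<in>U. k < j}. k < i}))"
      by (rule discrete_deriv_telescope) (use assms in auto)
    also have "\<dots> = (\<Sum>i\<in>{i\<in>U. i < j}. discrete_deriv i (discrete_deriv j g) (A \<union> {k\<in>U. k < i}))"
    proof (rule sum.cong)
      fix i assume "i \<in> {i\<in>U. i < j}"
      then have "{k\<in>{k\<in>U. k < j}. k < i} = {k\<in>U. k < i}" by auto
      then show "discrete_deriv i (discrete_deriv j g) (A \<union> {k\<in>{k\<in>U. k < j}. k < i}) =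
          discrete_deriv i (discrete_deriv j g) (A \<union> {k\<in>U. k < i})" by simp
    qed simp
    finally show ?thesis by (simp add: sum_negf)
  qed
  note * = this
  show ?thesis
    using discrete_deriv_telescope[OF assms, of g]
    by (simp add: *[symmetric] sum_subtractf)
qed

text \<open>The error of the linear approximation at the larger set. Here the first derivatives have to be
  moved up to \<open>A \<union> U\<close>, so the pairs appear in the opposite order.\<close>

lemma linearization_above:
  fixes g :: "'v::linorder set \<Rightarrow> real"
  assumes "finite U" "U \<inter> A = {}"
  shows "g (A \<union> U) - g A - (\<Sum>j\<in>U. discrete_deriv j g (A \<union> U)) =
    (\<Sum>j\<in>U. \<Sum>i\<in>{i\<in>U. j < i}. - discrete_deriv i (discrete_deriv j g) (A \<union> {k\<in>U. k < i}))"
proof -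
  have "discrete_deriv j g (A \<union> {k\<in>U. k < j}) - discrete_deriv j g (A \<union> U) =
    (\<Sum>i\<in>{i\<in>U. j < i}. - discrete_deriv i (discrete_deriv j g) (A \<union> {k\<in>U. k < i}))"
    if j: "j \<in> U" for j
  proof -
    (* The derivative in direction j ignores j, so the telescope may start after j was added; this
       keeps the vanishing term i = j out of the sum. *)
    let ?A = "A \<union> {k\<in>U. k \<le> j}"
    have "discrete_deriv j g (?A \<union> {k\<in>U. j < k}) - discrete_deriv j g ?A =
        (\<Sum>i\<in>{i\<in>U. j < i}. discrete_deriv i (discrete_deriv j g)
          (?A \<union> {k\<in>{k\<in>U. j < k}. k < i}))"
      by (rule discrete_deriv_telescope) (use assms in auto)
    also have "\<dots> = (\<Sum>i\<in>{i\<in>U. j < i}. discrete_deriv i (discrete_deriv j g) (A \<union> {k\<in>U. k < i}))"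
    proof (rule sum.cong)
      fix i assume "i \<in> {i\<in>U. j < i}"
      then have "?A \<union> {k\<in>{k\<in>U. j < k}. k < i} = A \<union> {k\<in>U. k < i}" by auto
      then show "discrete_deriv i (discrete_deriv j g) (?A \<union> {k\<in>{k\<in>U. j < k}. k < i}) =
          discrete_deriv i (discrete_deriv j g) (A \<union> {k\<in>U. k < i})" by simp
    qed simp
    also have "?A \<union> {k\<in>U. j < k} = A \<union> U" by auto
    also have "discrete_deriv j g ?A = discrete_deriv j g (A \<union> {k\<in>U. k < j})"
    proof -
      have "insert j ?A = insert j (A \<union> {k\<in>U. k < j})" "?A - {j} = A \<union> {k\<in>U. k < j} - {j}"
        by auto
      then show ?thesis unfolding discrete_deriv_def by metis
    qed
    finally show ?thesis by (simp add: sum_negf)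
  qed
  note * = this
  show ?thesis
    using discrete_deriv_telescope[OF assms, of g]
    by (simp add: *[symmetric] sum_subtractf cong: sum.cong)
qed

section \<open>Sums of squares on a finite set of points\<close>

text \<open>The points are given as a family \<open>pt\<close> over an index set \<open>K\<close>, and the function as a function of
  the index, so that it can be written directly in terms of subsets instead of their indicator
  vectors.\<close>

definition sos_on :: "'v set \<Rightarrow> nat \<Rightarrow> 'k set \<Rightarrow> ('k \<Rightarrow> 'v \<Rightarrow> real) \<Rightarrow> ('k \<Rightarrow> real) \<Rightarrow> bool" where
  "sos_on V d K pt \<phi> \<longleftrightarrow> (\<exists>qs. set qs \<subseteq> polys_le V d \<and>
     (\<forall>k\<in>K. \<phi> k = (\<Sum>q\<leftarrow>qs. eval (pt k) q ^ 2)))"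

lemma sos_on_cong:
  "(\<And>k. k \<in> K \<Longrightarrow> \<phi> k = \<psi> k) \<Longrightarrow> sos_on V d K pt \<phi> \<longleftrightarrow> sos_on V d K pt \<psi>"
  by (simp add: sos_on_def)

lemma sos_on_zero: "sos_on V d K pt (\<lambda>_. 0)"
  unfolding sos_on_def by (intro exI[of _ "[]"]) simp

lemma sos_on_add:
  assumes "sos_on V d K pt \<phi>" "sos_on V d K pt \<psi>"
  shows "sos_on V d K pt (\<lambda>k. \<phi> k + \<psi> k)"
proof -
  obtain qs rs where "set qs \<subseteq> polys_le V d" "\<forall>k\<in>K. \<phi> k = (\<Sum>q\<leftarrow>qs. eval (pt k) q ^ 2)"
    "set rs \<subseteq> polys_le V d" "\<forall>k\<in>K. \<psi> k = (\<Sum>q\<leftarrow>rs. eval (pt k) q ^ 2)"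
    using assms unfolding sos_on_def by blast
  then show ?thesis
    unfolding sos_on_def by (intro exI[of _ "qs @ rs"]) auto
qed

lemma sos_on_sum:
  "(\<And>i. i \<in> A \<Longrightarrow> sos_on V d K pt (\<phi> i)) \<Longrightarrow> sos_on V d K pt (\<lambda>k. \<Sum>i\<in>A. \<phi> i k)"
  by (induction A rule: infinite_finite_induct) (auto intro: sos_on_zero sos_on_add)

text \<open>Pulling a certificate back along a substitution of polynomials of degree at most 1 keeps its
  degree, and a square factor \<open>w\<^sup>2\<close> is absorbed into the squares by multiplying each of them
  by \<open>w\<close>.\<close>

lemma sos_on_square_mult_subst:
  assumes "sos_on V d K pt \<phi>"
    and w: "w \<in> polys_le W e"
    and \<sigma>: "\<And>v. v \<in> V \<Longrightarrow> \<sigma> v \<in> polys_le W 1"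
    and \<kappa>: "\<And>l. l \<in> L \<Longrightarrow> \<kappa> l \<in> K"
    and pt: "\<And>l v. l \<in> L \<Longrightarrow> v \<in> V \<Longrightarrow> eval (pt' l) (\<sigma> v) = pt (\<kappa> l) v"
  shows "sos_on W (d + e) L pt' (\<lambda>l. eval (pt' l) w ^ 2 * \<phi> (\<kappa> l))"
proof -
  obtain qs where qs: "set qs \<subseteq> polys_le V d" "\<forall>k\<in>K. \<phi> k = (\<Sum>q\<leftarrow>qs. eval (pt k) q ^ 2)"
    using assms(1) by (auto simp: sos_on_def)
  let ?rs = "map (\<lambda>q. subst \<sigma> q * w) qs"
  have "set ?rs \<subseteq> polys_le W (d + e)"
    using qs(1) by (auto intro!: polys_le_mult w polys_le_subst[of _ V] \<sigma>)
  moreover have "eval (pt' l) w ^ 2 * \<phi> (\<kappa> l) = (\<Sum>q\<leftarrow>?rs. eval (pt' l) q ^ 2)" if l: "l \<in> L" for l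
  proof -
    have "eval (\<lambda>v. eval (pt' l) (\<sigma> v)) q = eval (pt (\<kappa> l)) q" if "q \<in> set qs" for q
      by (rule eval_cong[of q V]) (use qs(1) that pt[OF l] in \<open>auto simp: polys_le_def\<close>)
    then have *: "map (\<lambda>q. eval (pt' l) (subst \<sigma> q * w) ^ 2) qs =
        map (\<lambda>q. eval (pt' l) w ^ 2 * eval (pt (\<kappa> l)) q ^ 2) qs"
      by (simp add: power_mult_distrib mult.commute)
    then show ?thesis
      using qs(2) \<kappa>[OF l] unfolding map_map comp_def * by (simp add: sum_list_const_mult)
  qed
  ultimately show ?thesis
    unfolding sos_on_def by blast
qed

text \<open>Modulo the vanishing ideal of a set of points, an identity of polynomials is an identity of
  functions on these points.\<close>

lemma sos_mod_iff_sos_on: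
  assumes "\<And>q. q \<in> polys V \<Longrightarrow> q \<in> I \<longleftrightarrow> (\<forall>k\<in>K. eval (pt k) q = 0)" "p \<in> polys V"
  shows "sos_mod V d I p \<longleftrightarrow> sos_on V d K pt (\<lambda>k. eval (pt k) p)"
proof -
  have "p - (\<Sum>q\<leftarrow>qs. q ^ 2) \<in> I \<longleftrightarrow> (\<forall>k\<in>K. eval (pt k) p = (\<Sum>q\<leftarrow>qs. eval (pt k) q ^ 2))"
    if "set qs \<subseteq> polys V" for qs
  proof -
    have "p - (\<Sum>q\<leftarrow>qs. q ^ 2) \<in> polys V"
      using that assms(2) by (auto intro!: polys_minus polys_sum_list polys_power)
    then show ?thesis by (simp add: assms(1))
  qed
  then show ?thesis
    unfolding sos_mod_def sos_on_def polys_le_def by (auto simp: subset_iff)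
qed

lemma in_boolean_ideal_iff_vanishes:
  assumes "finite V" "p \<in> polys V"
  shows "p \<in> ideal_gen V {Var k ^ 2 - Var k | k. k \<in> V} \<longleftrightarrow>
    (\<forall>C\<in>Pow V. eval (indicator_point C) p = 0)" (is "_ \<in> ideal_gen V ?G \<longleftrightarrow> _")
proof
  have zero: "eval (indicator_point C) g = 0" if "g \<in> ?G" for g C
    using that by (auto simp: indicator_point_def)
  {
    assume "p \<in> ideal_gen V ?G"
    then show "\<forall>C\<in>Pow V. eval (indicator_point C) p = 0"
      by (intro ballI eval_ideal_gen[of p V ?G] zero)
  next
    assume *: "\<forall>C\<in>Pow V. eval (indicator_point C) p = 0"
    show "p \<in> ideal_gen V ?G"
    proof (rule in_ideal_gen_if_vanishes[of V])
      fix C assume "C \<subseteq> V"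
      then show "\<exists>a. (\<forall>w\<in>V. a w = of_bool (w \<in> C)) \<and> (\<forall>g\<in>?G. eval a g = 0) \<and> eval a p = 0"
        using * zero by (intro exI[of _ "indicator_point C"]) (auto simp: indicator_point_def)
    qed (use assms in \<open>auto intro: ideal_gen_generator\<close>)
  }
qed

text \<open>The common zeros of the generators of \<open>I0\<close>: the vectors \<open>x\<close> and \<open>y\<close> are indicators of sets
  and \<open>x\<^sub>i * y\<^sub>i = s\<^sub>i\<close> makes \<open>s\<close> the indicator of their intersection.\<close>

fun meet_point :: "nat set \<times> nat set \<Rightarrow> xys \<Rightarrow> real" where
  "meet_point (A, B) (X i) = of_bool (i \<in> A)"
| "meet_point (A, B) (Y i) = of_bool (i \<in> B)"
| "meet_point (A, B) (S i) = of_bool (i \<in> A \<inter> B)"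

text \<open>The variables \<open>x\<^sub>i\<close> and \<open>y\<^sub>i\<close> are boolean, and \<open>s\<^sub>i\<close> is congruent to the product
  \<open>x\<^sub>i * y\<^sub>i\<close>.\<close>

lemma in_I0_iff_vanishes:
  assumes "p \<in> polys (xys_vars n)"
  shows "p \<in> I0 n \<longleftrightarrow> (\<forall>AB\<in>Pow {1..n} \<times> Pow {1..n}. eval (meet_point AB) p = 0)"
proof -
  define G where "G = (\<Union>i\<in>{1..n}.
     {Var (X i) ^ 2 - Var (X i), Var (X i) * Var (Y i) - Var (S i),
      Var (X i) * Var (S i) - Var (S i), Var (Y i) ^ 2 - Var (Y i),
      Var (Y i) * Var (S i) - Var (S i), Var (S i) ^ 2 - Var (S i)})"
  have I0: "I0 n = ideal_gen (xys_vars n) G"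
    by (simp add: I0_def G_def)
  have zero: "eval (meet_point AB) g = 0" if "g \<in> G" for g AB
    using that by (cases AB) (auto simp: G_def)
  show ?thesis
  proof
    assume "p \<in> I0 n"
    then show "\<forall>AB\<in>Pow {1..n} \<times> Pow {1..n}. eval (meet_point AB) p = 0"
      unfolding I0 by (intro ballI eval_ideal_gen[of p "xys_vars n" G] zero)
  next
    assume *: "\<forall>AB\<in>Pow {1..n} \<times> Pow {1..n}. eval (meet_point AB) p = 0"
    show "p \<in> I0 n"
      unfolding I0
    proof (rule in_ideal_gen_if_vanishes[of "X ` {1..n} \<union> Y ` {1..n}"])
      fix w assume "w \<in> X ` {1..n} \<union> Y ` {1..n}"
      then show "Var w ^ 2 - Var w \<in> ideal_gen (xys_vars n) G"
        by (intro ideal_gen_generator) (auto simp: G_def)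
    next
      fix v assume "v \<in> xys_vars n - (X ` {1..n} \<union> Y ` {1..n})"
      then obtain i where i: "i \<in> {1..n}" "v = S i"
        by (auto simp: xys_vars_def)
      have "- (Var (X i) * Var (Y i) - Var (S i)) \<in> ideal_gen (xys_vars n) G"
        by (intro ideal_gen_uminus ideal_gen_generator) (use i in \<open>auto simp: G_def\<close>)
      then show "\<exists>r\<in>polys (X ` {1..n} \<union> Y ` {1..n}). Var v - r \<in> ideal_gen (xys_vars n) G"
        using i by (intro bexI[of _ "Var (X i) * Var (Y i)"]) (auto intro!: polys_mult polys_Var)
    next
      fix C assume "C \<subseteq> X ` {1..n} \<union> Y ` {1..n}"
      define AB where "AB = ({i\<in>{1..n}. X i \<in> C}, {i\<in>{1..n}. Y i \<in> C})"
      have "AB \<in> Pow {1..n} \<times> Pow {1..n}" by (auto simp: AB_def)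
      then have "eval (meet_point AB) p = 0" using * by blast
      then show "\<exists>a. (\<forall>w\<in>X ` {1..n} \<union> Y ` {1..n}. a w = of_bool (w \<in> C)) \<and>
          (\<forall>g\<in>G. eval a g = 0) \<and> eval a p = 0"
        using zero by (intro exI[of _ "meet_point AB"]) (auto simp: AB_def)
    qed (use assms in \<open>auto simp: xys_vars_def\<close>)
  qed
qed

section \<open>Both sides of the equivalence on points\<close>

text \<open>The value of \<open>G2\<close> at the point of \<open>A\<close> and \<open>B\<close>: the coefficients \<open>y\<^sub>i - s\<^sub>i\<close> and
  \<open>x\<^sub>i - s\<^sub>i\<close> select the elements of \<open>B - A\<close> and of \<open>A - B\<close>.\<close>

definition G2_value :: "(nat set \<Rightarrow> real) \<Rightarrow> nat set \<Rightarrow> nat set \<Rightarrow> real" where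
  "G2_value g A B = g B - g A - (\<Sum>i\<in>B - A. discrete_deriv i g B)
     + (\<Sum>i\<in>A - B. discrete_deriv i g (A \<inter> B))"

lemma eval_G2:
  assumes F: "multilinear F" and AB: "A \<subseteq> {1..n}" "B \<subseteq> {1..n}"
  shows "eval (meet_point (A, B)) (G2 n F) = G2_value (\<lambda>C. eval (indicator_point C) F) A B"
proof -
  have sum: "(\<Sum>i=1..n. (of_bool (i \<in> C) - of_bool (i \<in> A \<inter> B)) * h i) = (\<Sum>i\<in>C - D. h i)"
    if "C \<subseteq> {1..n}" "C \<inter> D = A \<inter> B" for C D and h :: "nat \<Rightarrow> real"
  proof -
    have "(\<Sum>i=1..n. (of_bool (i \<in> C) - of_bool (i \<in> A \<inter> B)) * h i) =
        (\<Sum>i=1..n. if i \<in> C - D then h i else 0)"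
      using that by (intro sum.cong) auto
    also have "\<dots> = (\<Sum>i\<in>{1..n} \<inter> (C - D). h i)"
      by (simp add: sum.inter_restrict)
    also have "{1..n} \<inter> (C - D) = C - D" using that by auto
    finally show ?thesis .
  qed
  have pts: "(\<lambda>i. meet_point (A, B) (X i)) = indicator_point A"
    "(\<lambda>i. meet_point (A, B) (Y i)) = indicator_point B"
    "(\<lambda>i. meet_point (A, B) (S i)) = indicator_point (A \<inter> B)"
    by (auto simp: indicator_point_def)
  show ?thesis
    using sum[of A B] sum[of B A] AB
    by (simp add: G2_def G2_value_def Let_def pts eval_partial_indicator[OF F] Int_commute
        del: meet_point.simps) simp
qed

lemma polys_G2:
  assumes "multilinear F" "F \<in> polys {1..n}"
  shows "G2 n F \<in> polys (xys_vars n)"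
proof -
  have "subst (\<lambda>i. Var (Z i)) p \<in> polys (xys_vars n)"
    if "p \<in> polys {1..n}" "\<And>i. i \<in> {1..n} \<Longrightarrow> Z i \<in> xys_vars n" for p Z
    using that by (auto intro!: polys_subst polys_le_Var simp del: One_nat_def)
  moreover have "partial i F \<in> polys {1..n}" for i
    using polys_partial[OF assms, of i] unfolding polys_def by blast
  ultimately show ?thesis
    using assms unfolding G2_def Let_def
    by (intro polys_add polys_minus polys_sum polys_mult polys_Var) (auto simp: xys_vars_def)
qed

lemma sos_mod_I0_G2:
  assumes "multilinear F" "F \<in> polys {1..n}"
  shows "sos_mod (xys_vars n) d (I0 n) (G2 n F) \<longleftrightarrow>
    sos_on (xys_vars n) d (Pow {1..n} \<times> Pow {1..n}) meet_point
      (\<lambda>(A, B). G2_value (\<lambda>C. eval (indicator_point C) F) A B)"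
proof -
  have "sos_mod (xys_vars n) d (I0 n) (G2 n F) \<longleftrightarrow>
    sos_on (xys_vars n) d (Pow {1..n} \<times> Pow {1..n}) meet_point
      (\<lambda>AB. eval (meet_point AB) (G2 n F))"
    by (rule sos_mod_iff_sos_on) (use in_I0_iff_vanishes polys_G2[OF assms] in auto)
  also have "\<dots> \<longleftrightarrow> sos_on (xys_vars n) d (Pow {1..n} \<times> Pow {1..n}) meet_point
      (\<lambda>(A, B). G2_value (\<lambda>C. eval (indicator_point C) F) A B)"
    by (rule sos_on_cong) (auto simp: eval_G2[OF assms(1)])
  finally show ?thesis .
qed

lemma sos_mod_second_partial:
  fixes F :: "nat mpoly"
  assumes F: "multilinear F" "F \<in> polys {1..n}"
  shows "(let V = {1..n} - {i, j} in
      sos_mod V t (ideal_gen V {Var k ^ 2 - Var k | k. k \<in> V}) (- partial i (partial j F))) \<longleftrightarrow>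
    sos_on ({1..n} - {i, j}) t (Pow ({1..n} - {i, j})) indicator_point
      (\<lambda>C. - discrete_deriv i (discrete_deriv j (\<lambda>C. eval (indicator_point C) F)) C)"
proof -
  let ?V = "{1..n} - {i, j}"
  have "partial i (partial j F) \<in> polys ({1..n} - {j} - {i})"
    using F by (intro polys_partial multilinear_partial)
  also have "{1..n} - {j} - {i} = ?V" by auto
  finally have "- partial i (partial j F) \<in> polys ?V" by (rule polys_uminus)
  then have "sos_mod ?V t (ideal_gen ?V {Var k ^ 2 - Var k | k. k \<in> ?V}) (- partial i (partial j F)) \<longleftrightarrow>
      sos_on ?V t (Pow ?V) indicator_point (\<lambda>C. eval (indicator_point C) (- partial i (partial j F)))"
    by (intro sos_mod_iff_sos_on in_boolean_ideal_iff_vanishes) auto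
  then show ?thesis
    by (simp add: Let_def eval_partial_indicator multilinear_partial F(1))
qed

section \<open>Submodularity gives a certificate for \<open>G2\<close>\<close>

text \<open>Certificates for second derivatives are only available on subsets avoiding \<open>i\<close> and \<open>j\<close>; this
  transports them to all subsets.\<close>

lemma discrete_deriv2_minus:
  "discrete_deriv i (discrete_deriv j g) (C - {i, j}) = discrete_deriv i (discrete_deriv j g) C"
proof (cases "i = j")
  case True
  then show ?thesis by (simp add: discrete_deriv_def)
next
  case False
  have "insert j (insert i (C - {i, j})) = insert j (insert i C)"
    "insert i (C - {i, j}) - {j} = insert i C - {j}"
    "insert j (C - {i, j} - {i}) = insert j (C - {i})"
    "C - {i, j} - {i} - {j} = C - {i} - {j}"
    using False by auto
  then show ?thesis unfolding discrete_deriv_def by metis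
qed

text \<open>A sum over a set \<open>U\<close> that varies with the point becomes a sum over a fixed index set whose
  coefficients are squares of functions of the point.\<close>

lemma sum_filter_pairs:
  fixes h :: "'a \<Rightarrow> 'a \<Rightarrow> real"
  assumes "finite N" "U \<subseteq> N"
  shows "(\<Sum>j\<in>U. \<Sum>i\<in>{i\<in>U. R i j}. h i j) =
    (\<Sum>j\<in>N. \<Sum>i\<in>{i\<in>N. R i j}. (of_bool (i \<in> U) * of_bool (j \<in> U))\<^sup>2 * h i j)"
proof -
  have "(\<Sum>j\<in>U. \<Sum>i\<in>{i\<in>U. R i j}. h i j) =
      (\<Sum>j\<in>U. \<Sum>i\<in>{i\<in>N. R i j}. (of_bool (i \<in> U) * of_bool (j \<in> U))\<^sup>2 * h i j)"
    using assms by (intro sum.cong refl sum.mono_neutral_cong_left) auto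
  also have "\<dots> = (\<Sum>j\<in>N. \<Sum>i\<in>{i\<in>N. R i j}. (of_bool (i \<in> U) * of_bool (j \<in> U))\<^sup>2 * h i j)"
    using assms by (intro sum.mono_neutral_left) auto
  finally show ?thesis .
qed

text \<open>Both halves of \<open>G2\<close> have this shape, with \<open>D (A, B)\<close> one of the two set differences, \<open>Z\<close> the
  block of variables of the set that contains it, and \<open>R\<close> an order on the pairs. On the points,
  membership of \<open>i\<close> in \<open>D (A, B)\<close> is the value of \<open>z\<^sub>i - s\<^sub>i\<close>. The intermediate set is reached by
  substituting \<open>z\<^sub>k\<close> for the variables below \<open>i\<close> and \<open>s\<^sub>k\<close> for the others. Hence each term
  is the square of \<open>(z\<^sub>i - s\<^sub>i) * (z\<^sub>j - s\<^sub>j)\<close> times a sum of squares of polynomials of degree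
  at most \<open>t\<close>, obtained by substitution from a certificate for a second derivative.\<close>

lemma sos_on_second_derivs:
  fixes g :: "nat set \<Rightarrow> real" and D :: "nat set \<times> nat set \<Rightarrow> nat set"
  assumes sub: "\<And>i j. i \<in> {1..n} \<Longrightarrow> j \<in> {1..n} \<Longrightarrow> i \<noteq> j \<Longrightarrow>
      sos_on ({1..n} - {i, j}) t (Pow ({1..n} - {i, j})) indicator_point
        (\<lambda>C. - discrete_deriv i (discrete_deriv j g) C)"
    and Z: "\<And>i. i \<in> {1..n} \<Longrightarrow> Z i \<in> xys_vars n"
    and D: "\<And>A B. A \<subseteq> {1..n} \<Longrightarrow> B \<subseteq> {1..n} \<Longrightarrow> D (A, B) \<subseteq> {1..n} - A \<inter> B"
    and pt: "\<And>A B i. meet_point (A, B) (Z i) = of_bool (i \<in> D (A, B) \<union> A \<inter> B)"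
    and R: "\<And>i j. R i j \<Longrightarrow> i \<noteq> j"
  shows "sos_on (xys_vars n) (t + 2) (Pow {1..n} \<times> Pow {1..n}) meet_point
    (\<lambda>(A, B). \<Sum>j\<in>D (A, B). \<Sum>i\<in>{i\<in>D (A, B). R i j}.
       - discrete_deriv i (discrete_deriv j g) (A \<inter> B \<union> {k\<in>D (A, B). k < i}))"
proof -
  let ?K = "Pow {1..n} \<times> Pow {1..n}"
  let ?d = "\<lambda>i. Var (Z i) - Var (S i)"
  define \<kappa> where "\<kappa> i j = (\<lambda>(A, B). A \<inter> B \<union> {k\<in>D (A, B). k < i} - {i, j})" for i j
  have SV: "S k \<in> xys_vars n" if "k \<in> {1..n}" for k
    using that by (auto simp: xys_vars_def)
  have "sos_on (xys_vars n) (t + 2) ?K meet_point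
      (\<lambda>AB. \<Sum>j=1..n. \<Sum>i\<in>{i\<in>{1..n}. R i j}.
         eval (meet_point AB) (?d i * ?d j) ^ 2 * - discrete_deriv i (discrete_deriv j g) (\<kappa> i j AB))"
  proof (intro sos_on_sum)
    fix i j assume j: "j \<in> {1..n}" and "i \<in> {i\<in>{1..n}. R i j}"
    then have i: "i \<in> {1..n}" and ij: "i \<noteq> j" using R by auto
    show "sos_on (xys_vars n) (t + 2) ?K meet_point
        (\<lambda>AB. eval (meet_point AB) (?d i * ?d j) ^ 2 * - discrete_deriv i (discrete_deriv j g) (\<kappa> i j AB))"
    proof (rule sos_on_square_mult_subst[OF sub[OF i j ij]])
      have "?d i * ?d j \<in> polys_le (xys_vars n) (1 + 1)"
        using i j by (intro polys_le_mult polys_le_minus polys_le_Var Z SV)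
      then show "?d i * ?d j \<in> polys_le (xys_vars n) 2"
        by (simp add: numeral_2_eq_2)
    next
      fix v assume "v \<in> {1..n} - {i, j}"
      then show "(if v < i then Var (Z v) else Var (S v)) \<in> polys_le (xys_vars n) 1"
        using Z[of v] SV[of v] polys_le_Var by auto
    next
      fix AB assume "AB \<in> ?K"
      then obtain A B where AB: "AB = (A, B)" "A \<subseteq> {1..n}" "B \<subseteq> {1..n}" by blast
      then show "\<kappa> i j AB \<in> Pow ({1..n} - {i, j})"
        using D[OF AB(2,3)] unfolding \<kappa>_def by (simp only: prod.case) blast
    next
      fix AB v assume "AB \<in> ?K" "v \<in> {1..n} - {i, j}"
      then show "eval (meet_point AB) (if v < i then Var (Z v) else Var (S v)) =
          indicator_point (\<kappa> i j AB) v"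
        by (cases AB) (auto simp: \<kappa>_def indicator_point_def pt)
    qed
  qed
  moreover have "(\<Sum>j=1..n. \<Sum>i\<in>{i\<in>{1..n}. R i j}.
         eval (meet_point AB) (?d i * ?d j) ^ 2 * - discrete_deriv i (discrete_deriv j g) (\<kappa> i j AB)) =
      (case AB of (A, B) \<Rightarrow> \<Sum>j\<in>D (A, B). \<Sum>i\<in>{i\<in>D (A, B). R i j}.
       - discrete_deriv i (discrete_deriv j g) (A \<inter> B \<union> {k\<in>D (A, B). k < i}))"
    if AB_in: "AB \<in> ?K" for AB
  proof -
    obtain A B where AB: "AB = (A, B)" by (cases AB)
    have sub: "D (A, B) \<subseteq> {1..n} - A \<inter> B" using D AB_in AB by auto
    then have d: "eval (meet_point (A, B)) (?d i) = of_bool (i \<in> D (A, B))" for i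
      by (auto simp: pt)
    have "D (A, B) \<subseteq> {1..n}" using sub by blast
    then show ?thesis
      by (simp add: AB \<kappa>_def discrete_deriv2_minus sum_filter_pairs[of "{1..n}"] d
          del: eval_minus eval_Var)
  qed
  ultimately show ?thesis
    by (subst sos_on_cong) auto
qed

text \<open>Insert and subtract \<open>g (A \<inter> B)\<close>: the part with \<open>A\<close> is the error of a linearization at the
  smaller set \<open>A \<inter> B\<close>, the part with \<open>B\<close> that of a linearization at the larger set \<open>B\<close>.\<close>

lemma G2_value_eq_second_derivs:
  assumes "finite A" "finite B"
  shows "G2_value g A B =
    (\<Sum>j\<in>A - B. \<Sum>i\<in>{i\<in>A - B. i < j}.
       - discrete_deriv i (discrete_deriv j g) (A \<inter> B \<union> {k\<in>A - B. k < i})) +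
    (\<Sum>j\<in>B - A. \<Sum>i\<in>{i\<in>B - A. j < i}.
       - discrete_deriv i (discrete_deriv j g) (A \<inter> B \<union> {k\<in>B - A. k < i}))"
proof -
  have eq: "A \<inter> B \<union> (A - B) = A" "A \<inter> B \<union> (B - A) = B" by auto
  have "finite (A - B)" "(A - B) \<inter> (A \<inter> B) = {}" "finite (B - A)" "(B - A) \<inter> (A \<inter> B) = {}"
    using assms by auto
  note linearization_below[OF this(1,2), of g] linearization_above[OF this(3,4), of g]
  then show ?thesis
    unfolding G2_value_def eq by linarith
qed

lemma sos_on_G2_value:
  assumes sub: "\<And>i j. i \<in> {1..n} \<Longrightarrow> j \<in> {1..n} \<Longrightarrow> i \<noteq> j \<Longrightarrow>
      sos_on ({1..n} - {i, j}) t (Pow ({1..n} - {i, j})) indicator_point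
        (\<lambda>C. - discrete_deriv i (discrete_deriv j g) C)"
  shows "sos_on (xys_vars n) (t + 2) (Pow {1..n} \<times> Pow {1..n}) meet_point
    (\<lambda>(A, B). G2_value g A B)"
proof -
  have "sos_on (xys_vars n) (t + 2) (Pow {1..n} \<times> Pow {1..n}) meet_point
    (\<lambda>(A, B). \<Sum>j\<in>(\<lambda>(A, B). A - B) (A, B). \<Sum>i\<in>{i\<in>(\<lambda>(A, B). A - B) (A, B). i < j}.
       - discrete_deriv i (discrete_deriv j g) (A \<inter> B \<union> {k\<in>(\<lambda>(A, B). A - B) (A, B). k < i}))"
    by (rule sos_on_second_derivs[OF sub, where Z = X]) (auto simp: xys_vars_def)
  moreover have "sos_on (xys_vars n) (t + 2) (Pow {1..n} \<times> Pow {1..n}) meet_point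
    (\<lambda>(A, B). \<Sum>j\<in>(\<lambda>(A, B). B - A) (A, B). \<Sum>i\<in>{i\<in>(\<lambda>(A, B). B - A) (A, B). j < i}.
       - discrete_deriv i (discrete_deriv j g) (A \<inter> B \<union> {k\<in>(\<lambda>(A, B). B - A) (A, B). k < i}))"
    by (rule sos_on_second_derivs[OF sub, where Z = Y]) (auto simp: xys_vars_def)
  ultimately show ?thesis
    by (rule sos_on_add[THEN sos_on_cong[THEN iffD1, rotated]])
       (auto simp: G2_value_eq_second_derivs finite_subset[of _ "{1..n}"])
qed

section \<open>A certificate for \<open>G2\<close> gives submodularity\<close>

text \<open>For distinct \<open>u\<close> and \<open>w\<close>, the second difference of \<open>q\<close> in these variables between 0 and 1,
  followed by the substitution
  \<open>\<sigma>\<close> for the other variables. A monomial survives exactly if it contains both \<open>u\<close> and \<open>w\<close>, to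
  whatever powers, and loses these powers.\<close>

definition mixed_difference ::
    "'v \<Rightarrow> 'v \<Rightarrow> ('v \<Rightarrow> 'w mpoly) \<Rightarrow> 'v mpoly \<Rightarrow> 'w mpoly" where
  "mixed_difference u w \<sigma> q =
     (\<Sum>m\<in>{m \<in> Poly_Mapping.keys q. u \<in> Poly_Mapping.keys m \<and> w \<in> Poly_Mapping.keys m}.
        Const (Poly_Mapping.lookup q m) *
        (\<Prod>v\<in>Poly_Mapping.keys m - {u, w}. \<sigma> v ^ Poly_Mapping.lookup m v))"

text \<open>The two removed powers account for at least two degrees.\<close>

lemma polys_le_mixed_difference:
  assumes q: "q \<in> polys_le V (d + 2)" and \<sigma>: "\<And>v. v \<in> V \<Longrightarrow> \<sigma> v \<in> polys_le W 1" and "u \<noteq> w"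
  shows "mixed_difference u w \<sigma> q \<in> polys_le W d"
  unfolding mixed_difference_def
proof (rule polys_le_sum)
  fix m assume "m \<in> {m \<in> Poly_Mapping.keys q. u \<in> Poly_Mapping.keys m \<and> w \<in> Poly_Mapping.keys m}"
  then have m: "m \<in> Poly_Mapping.keys q" and uw: "u \<in> Poly_Mapping.keys m" "w \<in> Poly_Mapping.keys m"
    by auto
  have sub: "Poly_Mapping.keys m \<subseteq> V" "monom_deg m \<le> d + 2"
    using q m by (auto simp: polys_le_iff)
  let ?rest = "\<Sum>v\<in>Poly_Mapping.keys m - {u, w}. Poly_Mapping.lookup m v"
  have "monom_deg m = ?rest + (\<Sum>v\<in>{u, w}. Poly_Mapping.lookup m v)"
    unfolding monom_deg_def using uw by (intro sum.subset_diff) auto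
  moreover have "Poly_Mapping.lookup m u \<ge> 1" "Poly_Mapping.lookup m w \<ge> 1"
    using uw by (auto simp: in_keys_iff)
  ultimately have rest: "?rest \<le> d"
    using sub(2) \<open>u \<noteq> w\<close> by simp
  have "\<sigma> v ^ Poly_Mapping.lookup m v \<in> polys_le W (Poly_Mapping.lookup m v)"
    if "v \<in> Poly_Mapping.keys m - {u, w}" for v
    using polys_le_power[OF \<sigma>, of v "Poly_Mapping.lookup m v"] that sub by auto
  then have "(\<Prod>v\<in>Poly_Mapping.keys m - {u, w}. \<sigma> v ^ Poly_Mapping.lookup m v) \<in> polys_le W ?rest"
    by (rule polys_le_prod)
  then have "Const (Poly_Mapping.lookup q m) *
      (\<Prod>v\<in>Poly_Mapping.keys m - {u, w}. \<sigma> v ^ Poly_Mapping.lookup m v) \<in> polys_le W (0 + ?rest)"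
    by (intro polys_le_mult polys_le_Const)
  then show "Const (Poly_Mapping.lookup q m) *
      (\<Prod>v\<in>Poly_Mapping.keys m - {u, w}. \<sigma> v ^ Poly_Mapping.lookup m v) \<in> polys_le W d"
    by (rule polys_le_mono) (use rest in auto)
qed

lemma eval_mixed_difference:
  assumes "u \<noteq> w"
  defines "a \<equiv> \<lambda>b \<sigma> v. eval b (\<sigma> v)"
  shows "eval b (mixed_difference u w \<sigma> q) =
    eval ((a b \<sigma>)(u := 1, w := 1)) q - eval ((a b \<sigma>)(u := 1, w := 0)) q
    - eval ((a b \<sigma>)(u := 0, w := 1)) q + eval ((a b \<sigma>)(u := 0, w := 0)) q"
proof -
  let ?a = "a b \<sigma>"
  define r where "r m = (\<Prod>v\<in>Poly_Mapping.keys m - {u, w}. ?a v ^ Poly_Mapping.lookup m v)" for m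
  have split: "monom_eval (?a(u := x, w := y)) m =
      x ^ Poly_Mapping.lookup m u * y ^ Poly_Mapping.lookup m w * r m" for x y m
  proof -
    let ?b = "?a(u := x, w := y)" and ?K = "insert u (insert w (Poly_Mapping.keys m - {u, w}))"
    have "monom_eval ?b m = (\<Prod>v\<in>?K. ?b v ^ Poly_Mapping.lookup m v)"
      by (rule monom_eval_superset) auto
    also have "\<dots> = x ^ Poly_Mapping.lookup m u * y ^ Poly_Mapping.lookup m w *
        (\<Prod>v\<in>Poly_Mapping.keys m - {u, w}. ?b v ^ Poly_Mapping.lookup m v)"
      using assms(1) by simp
    also have "(\<Prod>v\<in>Poly_Mapping.keys m - {u, w}. ?b v ^ Poly_Mapping.lookup m v) = r m"
      unfolding r_def by (rule prod.cong) auto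
    finally show ?thesis .
  qed
  have "eval b (mixed_difference u w \<sigma> q) =
      (\<Sum>m\<in>{m \<in> Poly_Mapping.keys q. u \<in> Poly_Mapping.keys m \<and> w \<in> Poly_Mapping.keys m}.
        Poly_Mapping.lookup q m * r m)"
    by (simp add: mixed_difference_def r_def a_def)
  also have "\<dots> = (\<Sum>m\<in>Poly_Mapping.keys q. Poly_Mapping.lookup q m *
      (if u \<in> Poly_Mapping.keys m \<and> w \<in> Poly_Mapping.keys m then r m else 0))"
    by (rule sum.mono_neutral_cong_left) auto
  also have "\<dots> = (\<Sum>m\<in>Poly_Mapping.keys q. Poly_Mapping.lookup q m *
      (monom_eval (?a(u := 1, w := 1)) m - monom_eval (?a(u := 1, w := 0)) m
       - monom_eval (?a(u := 0, w := 1)) m + monom_eval (?a(u := 0, w := 0)) m))"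
    unfolding split by (intro sum.cong refl) (auto simp: in_keys_iff power_0_left)
  finally show ?thesis
    by (simp add: eval_altdef[of _ q] distrib_left right_diff_distrib sum.distrib sum_subtractf)
qed

text \<open>For \<open>C\<close> without \<open>i\<close> and \<open>j\<close>, the value of \<open>G2\<close> at \<open>A = C \<union> {i, j}\<close>, \<open>B = C\<close> is the negated
  second derivative, while it is 0 if \<open>A\<close> is \<open>C\<close>, \<open>C \<union> {i}\<close> or \<open>C \<union> {j}\<close>. A sum of real
  squares vanishes only if every term does, so each \<open>q\<close> in a certificate for \<open>G2\<close> is 0 at the
  latter three points. Its value at the first point is therefore equal to its second difference
  there, which is given by a polynomial of degree at most \<open>t\<close>.\<close>

lemma sos_on_second_deriv:
  assumes G2: "sos_on (xys_vars n) (t + 2) (Pow {1..n} \<times> Pow {1..n}) meet_point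
      (\<lambda>(A, B). G2_value g A B)"
    and ij: "i \<in> {1..n}" "j \<in> {1..n}" "i \<noteq> j"
  shows "sos_on ({1..n} - {i, j}) t (Pow ({1..n} - {i, j})) indicator_point
        (\<lambda>C. - discrete_deriv i (discrete_deriv j g) C)"
proof -
  let ?V = "{1..n} - {i, j}"
  obtain qs where qs: "set qs \<subseteq> polys_le (xys_vars n) (t + 2)"
    and G2_eq: "\<And>A B. A \<subseteq> {1..n} \<Longrightarrow> B \<subseteq> {1..n} \<Longrightarrow>
        G2_value g A B = (\<Sum>q\<leftarrow>qs. eval (meet_point (A, B)) q ^ 2)"
    using G2 by (fastforce simp: sos_on_def)
  (* At the four points involved, all three blocks of variables carry the indicator of C, except that
     X i and X j vary; the other variables with index i or j are 0 there. *)
  define \<sigma> :: "xys \<Rightarrow> nat mpoly" where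
    "\<sigma> v = (let k = (case v of X k \<Rightarrow> k | Y k \<Rightarrow> k | S k \<Rightarrow> k) in if k \<in> {i, j} then 0 else Var k)" for v
  let ?r = "mixed_difference (X i) (X j) \<sigma>"
  have \<sigma>: "\<sigma> v \<in> polys_le ?V 1" if "v \<in> xys_vars n" for v
    using that by (auto simp: \<sigma>_def xys_vars_def Let_def simp del: One_nat_def intro: polys_le_Var)
  have "set (map ?r qs) \<subseteq> polys_le ?V t"
    using qs ij \<sigma> by (auto simp del: One_nat_def intro!: polys_le_mixed_difference[of _ "xys_vars n"])
  moreover have "- discrete_deriv i (discrete_deriv j g) C =
      (\<Sum>q\<leftarrow>map ?r qs. eval (indicator_point C) q ^ 2)" if C: "C \<in> Pow ?V" for C
  proof -
    have notin: "i \<notin> C" "j \<notin> C" and sub: "C \<subseteq> {1..n}" using C by auto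
    have zero: "eval (meet_point (A, C)) q = 0"
      if "A \<in> {C, insert i C, insert j C}" "q \<in> set qs" for A q
    proof -
      have "G2_value g A C = 0"
        using that(1) notin by (auto simp: G2_value_def discrete_deriv_def insert_Diff_if Int_insert_left)
      moreover have "A \<subseteq> {1..n}" using that(1) sub ij by auto
      ultimately have "(\<Sum>q\<leftarrow>qs. eval (meet_point (A, C)) q ^ 2) = 0"
        using G2_eq[of A C] sub by simp
      then show ?thesis
        using that(2) by (subst (asm) sum_list_nonneg_eq_0_iff) auto
    qed
    let ?a = "\<lambda>v. eval (indicator_point C) (\<sigma> v)"
    have pts:
      "?a(X i := 1, X j := 1) = meet_point (insert i (insert j C), C)"
      "?a(X i := 1, X j := 0) = meet_point (insert i C, C)"
      "?a(X i := 0, X j := 1) = meet_point (insert j C, C)"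
      "?a(X i := 0, X j := 0) = meet_point (C, C)"
      using notin ij
      by (auto simp: fun_eq_iff \<sigma>_def Let_def indicator_point_def split: xys.split)
    have r: "eval (indicator_point C) (?r q) = eval (meet_point (insert i (insert j C), C)) q"
      if "q \<in> set qs" for q
      using that ij zero by (simp add: eval_mixed_difference pts)
    have "G2_value g (insert i (insert j C)) C = - discrete_deriv i (discrete_deriv j g) C"
      using notin ij
      by (simp add: G2_value_def discrete_deriv_def insert_Diff_if Int_insert_left insert_commute)
    moreover have "G2_value g (insert i (insert j C)) C =
        (\<Sum>q\<leftarrow>qs. eval (meet_point (insert i (insert j C), C)) q ^ 2)"
      by (rule G2_eq) (use sub ij in auto)
    moreover have "map (\<lambda>q. eval (meet_point (insert i (insert j C), C)) q ^ 2) qs =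
        map (\<lambda>q. eval (indicator_point C) (?r q) ^ 2) qs"
      by (simp add: r)
    ultimately show ?thesis by (simp add: comp_def)
  qed
  ultimately show ?thesis
    unfolding sos_on_def by blast
qed

theorem theorem6:
  fixes t n :: nat and f :: "nat set \<Rightarrow> real"
  shows "sos_submodular t n f \<longleftrightarrow>
    sos_mod (xys_vars n) (t + 2) (I0 n) (G2 n (mle n f))"
proof -
  let ?F = "mle n f"
  have F: "multilinear ?F" "?F \<in> polys {1..n}"
    using is_mle_mle[of n f] by (simp_all add: is_mle_def)
  show ?thesis
    unfolding sos_submodular_def sos_mod_second_partial[OF F] sos_mod_I0_G2[OF F]
    using sos_on_G2_value sos_on_second_deriv by blast
qed

end
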